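(* Assume that $H:\mathbb{R}\to\mathbb{R}$ is continuous, that $F:\mathbb{R}\to\mathbb{R}$ is continuous, non-increasing and satisfies $\lim_{p\to-\infty}F(p)=+\infty$, and that $u_0:[0,+\infty)\to\mathbb{R}$ is uniformly continuous. Assume moreover that at least one of the following holds: (1) $\lim_{p\to+\infty}F(p)=-\infty$; (2) $\lim_{|p|\to+\infty}H(p)=+\infty$. Then for every relaxed sub-solution $u$ and every relaxed super-solution $v$ of $$u_t+H(u_x)=0\ \text{ for } t\in(0,T),\ x>0,\qquad u_t+F(u_x)=0\ \text{ for } t\in(0,T),\ x=0,$$ with initial condition $u(0,x)=u_0(x)$ for $x\ge0$, satisfying for some $T>0$ and $C_T>0$ $$u(t,x)\le C_T(1+x),\qquad v(t,x)\ge -C_T(1+x)\qquad \forall (t,x)\in(0,T)\times[0,+\infty),$$ we have $u\le v$ in $[0,T)\times[0,+\infty)$.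
   Context: Test functions are $C^1$ functions on $(0,T)\times[0,+\infty)$. For a (locally bounded) $u:[0,T)\times[0,+\infty)\to\mathbb{R}$, $u^*(t,x)=\limsup_{(s,y)\to(t,x)}u(s,y)$ and $u_*(t,x)=\liminf_{(s,y)\to(t,x)}u(s,y)$. A test function $\phi$ touches a function $w$ from above (resp. below) at a point if $w-\phi$ has a local maximum (resp. minimum) there. $u$ is a relaxed sub-solution (resp. relaxed super-solution) of the initial boundary value problem if: for every test function $\phi$ touching $u^*$ from above (resp. $u_*$ from below) at $(t_0,x_0)\in(0,T)\times[0,+\infty)$, when $x_0>0$ one has $\phi_t+H(\phi_x)\le0$ (resp. $\ge0$) at $(t_0,x_0)$, and when $x_0=0$ one has either $\phi_t+H(\phi_x)\le0$ or $\phi_t+F(\phi_x)\le0$ (resp. either $\phi_t+H(\phi_x)\ge0$ or $\phi_t+F(\phi_x)\ge0$) at $(t_0,0)$; and additionally $u^*(0,x)\le u_0(x)$ (resp. $u_*(0,x)\ge u_0(x)$) for all $x\in[0,+\infty)$. *)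

theory Defs
  imports "HOL-Analysis.Analysis"
begin

definition dom_init :: "real \<Rightarrow> (real \<times> real) set" where
  "dom_init T = {0..<T} \<times> {0..}"

definition dom_pos :: "real \<Rightarrow> (real \<times> real) set" where
  "dom_pos T = {0<..<T} \<times> {0..}"

definition locally_bounded_on :: "'a::topological_space set \<Rightarrow> ('a \<Rightarrow> real) \<Rightarrow> bool" where
  "locally_bounded_on S u \<longleftrightarrow> (\<forall>p\<in>S. \<exists>U. open U \<and> p \<in> U \<and> bounded (u ` (U \<inter> S)))"

text \<open>
  Semicontinuous envelopes relative to \<open>S\<close>. The limits are taken over all points of \<open>S\<close>
  near \<open>p\<close>, including \<open>p\<close> itself, so that \<open>lsc_env S u p \<le> u p \<le> usc_env S u p\<close> for \<open>p \<in> S\<close>;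
  this is why the filter is not \<open>at p within S\<close>. They take extended real values, which are
  finite on \<open>S\<close> when \<open>u\<close> is locally bounded on \<open>S\<close>.
\<close>

definition usc_env :: "'a::topological_space set \<Rightarrow> ('a \<Rightarrow> real) \<Rightarrow> 'a \<Rightarrow> ereal" where
  "usc_env S u p = Limsup (inf (nhds p) (principal S)) (\<lambda>q. ereal (u q))"

definition lsc_env :: "'a::topological_space set \<Rightarrow> ('a \<Rightarrow> real) \<Rightarrow> 'a \<Rightarrow> ereal" where
  "lsc_env S u p = Liminf (inf (nhds p) (principal S)) (\<lambda>q. ereal (u q))"

text \<open>
  \<open>\<phi>\<close> is continuously differentiable on \<open>S\<close> with partial derivatives \<open>\<phi>t\<close> and \<open>\<phi>x\<close>.
  Derivatives are taken within \<open>S\<close>, hence one-sided in \<open>x\<close> at boundary points \<open>(t, 0)\<close>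
  of \<open>dom_pos T\<close>.
\<close>

definition C1_test_on ::
  "(real \<times> real) set \<Rightarrow> (real \<times> real \<Rightarrow> real) \<Rightarrow> (real \<times> real \<Rightarrow> real) \<Rightarrow> (real \<times> real \<Rightarrow> real) \<Rightarrow> bool"
  where
  "C1_test_on S \<phi> \<phi>t \<phi>x \<longleftrightarrow>
     (\<forall>p\<in>S. (\<phi> has_derivative (\<lambda>(h, k). \<phi>t p * h + \<phi>x p * k)) (at p within S)) \<and>
     continuous_on S \<phi>t \<and> continuous_on S \<phi>x"

definition touches_from_above ::
  "'a::topological_space set \<Rightarrow> ('a \<Rightarrow> real) \<Rightarrow> ('a \<Rightarrow> ereal) \<Rightarrow> 'a \<Rightarrow> bool" where
  "touches_from_above S \<phi> w p \<longleftrightarrow>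
     (\<forall>\<^sub>F q in at p within S. w q - ereal (\<phi> q) \<le> w p - ereal (\<phi> p))"

definition touches_from_below ::
  "'a::topological_space set \<Rightarrow> ('a \<Rightarrow> real) \<Rightarrow> ('a \<Rightarrow> ereal) \<Rightarrow> 'a \<Rightarrow> bool" where
  "touches_from_below S \<phi> w p \<longleftrightarrow>
     (\<forall>\<^sub>F q in at p within S. w p - ereal (\<phi> p) \<le> w q - ereal (\<phi> q))"

definition relaxed_subsolution ::
  "real \<Rightarrow> (real \<Rightarrow> real) \<Rightarrow> (real \<Rightarrow> real) \<Rightarrow> (real \<Rightarrow> real) \<Rightarrow> (real \<times> real \<Rightarrow> real) \<Rightarrow> bool" where
  "relaxed_subsolution T H F u0 u \<longleftrightarrow>
     locally_bounded_on (dom_init T) u \<and>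
     (\<forall>\<phi> \<phi>t \<phi>x t x.
        C1_test_on (dom_pos T) \<phi> \<phi>t \<phi>x \<longrightarrow> (t, x) \<in> dom_pos T \<longrightarrow>
        touches_from_above (dom_pos T) \<phi> (usc_env (dom_init T) u) (t, x) \<longrightarrow>
        (x > 0 \<longrightarrow> \<phi>t (t, x) + H (\<phi>x (t, x)) \<le> 0) \<and>
        (x = 0 \<longrightarrow> \<phi>t (t, x) + H (\<phi>x (t, x)) \<le> 0 \<or> \<phi>t (t, x) + F (\<phi>x (t, x)) \<le> 0)) \<and>
     (\<forall>x\<ge>0. usc_env (dom_init T) u (0, x) \<le> ereal (u0 x))"

definition relaxed_supersolution ::
  "real \<Rightarrow> (real \<Rightarrow> real) \<Rightarrow> (real \<Rightarrow> real) \<Rightarrow> (real \<Rightarrow> real) \<Rightarrow> (real \<times> real \<Rightarrow> real) \<Rightarrow> bool" where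
  "relaxed_supersolution T H F u0 u \<longleftrightarrow>
     locally_bounded_on (dom_init T) u \<and>
     (\<forall>\<phi> \<phi>t \<phi>x t x.
        C1_test_on (dom_pos T) \<phi> \<phi>t \<phi>x \<longrightarrow> (t, x) \<in> dom_pos T \<longrightarrow>
        touches_from_below (dom_pos T) \<phi> (lsc_env (dom_init T) u) (t, x) \<longrightarrow>
        (x > 0 \<longrightarrow> \<phi>t (t, x) + H (\<phi>x (t, x)) \<ge> 0) \<and>
        (x = 0 \<longrightarrow> \<phi>t (t, x) + H (\<phi>x (t, x)) \<ge> 0 \<or> \<phi>t (t, x) + F (\<phi>x (t, x)) \<ge> 0)) \<and>
     (\<forall>x\<ge>0. lsc_env (dom_init T) u (0, x) \<ge> ereal (u0 x))"

end

theory Submission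
  imports Defs
begin

text \<open>
  Let \<open>U\<close> be the upper envelope of \<open>u\<close> and \<open>V\<close> that of \<open>- v\<close>. The function \<open>- v\<close> is a
  subsolution for the reflected nonlinearities \<open>p \<mapsto> - H (- p)\<close> and \<open>p \<mapsto> - F (- p)\<close>, so the
  claim becomes \<open>U + V \<le> 0\<close> for two subsolutions, and every estimate is needed for
  subsolutions only.

  First, barriers with bounded slopes (\<open>barrier_bound\<close>) show that \<open>U\<close> and \<open>V\<close> leave their
  initial data at finite speed. As the data are \<open>u0\<close> and \<open>- u0\<close>, this bounds
  \<open>U (t, x) + V (s, y)\<close> by \<open>\<delta> + L (t + s) + L \<bar>x - y\<bar>\<close> for every \<open>\<delta> > 0\<close>, with \<open>L\<close>
  depending on \<open>\<delta>\<close>. So the sum is controlled at infinity, and a positive value cannot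
  come from small times.

  Suppose \<open>U + V\<close> is positive somewhere. Subtract \<open>\<sigma> / (T - t)\<close> from both functions, which
  makes them strict subsolutions \<open>A\<close> and \<open>B\<close>, and double the variables with penalties
  \<open>(t - s)\<^sup>2 / (2 \<nu>)\<close>, \<open>(x - y)\<^sup>2 / (2 \<epsilon>)\<close> and \<open>\<alpha> x\<close>. A maximum with \<open>x, y > 0\<close> gives
  \<open>2 m + H (p + \<alpha>) \<le> H p\<close> at \<open>p = (x - y) / \<epsilon>\<close>. For fixed \<open>\<epsilon>\<close> this \<open>p\<close> stays bounded as
  \<open>\<alpha> \<rightarrow> 0\<close>, so continuity of \<open>H\<close> alone forces \<open>x = 0\<close> or \<open>y = 0\<close>. Letting \<open>\<epsilon> \<rightarrow> 0\<close>
  afterwards, \<open>A (t, x) + B (s, x) - (t - s)\<^sup>2 / (2 \<nu>)\<close> attains its maximum at a boundary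
  point \<open>(t0, s0, 0)\<close> (\<open>boundary_maximum\<close>).

  There the space penalty is gone, and the two subsolutions are compared through their slopes
  at \<open>x = 0\<close>. After subtracting the time behaviour dictated by the maximum, \<open>A\<close> and \<open>B\<close> become
  profiles \<open>W\<close> and \<open>Z\<close> with \<open>W + Z \<le> 0\<close>, for which effectively \<open>H \<le> a\<close> and \<open>H \<ge> b\<close> are
  the viscosity inequalities in \<open>x > 0\<close>, with \<open>a < b\<close>. The lines \<open>p x\<close> above \<open>W\<close> near \<open>0\<close>
  form an upward closed set of slopes, the lines \<open>p x\<close> below \<open>- Z\<close> a downward closed one.
  \<^item> Each \<open>p\<close> lies in one of the two sets: otherwise both profiles oscillate about the line
    \<open>p x\<close> and have interior contacts of slope exactly \<open>p\<close>, so \<open>b \<le> H p \<le> a\<close>.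
  \<^item> At the critical slopes, the ends of the two sets, \<open>H \<le> a\<close> and \<open>H \<ge> b\<close> respectively.
    If a set is all of the line its end is at infinity. Then the inequality for \<open>H\<close> holds for
    all extreme slopes, either because the growth of \<open>F\<close> excludes the alternative inequality
    or because \<open>H\<close> is coercive.
  \<^item> Between the ends some \<open>p\<close> has \<open>a < H p < b\<close>. The line \<open>p x\<close> touches both profiles at the
    boundary, and there the relaxed conditions can only hold as \<open>F p \<le> a\<close> and \<open>F p \<ge> b\<close>.

  This contradiction is \<open>boundary_profiles_contradiction\<close>.
\<close>

section \<open>Upper semicontinuity\<close>

definition usc_on :: "'a::topological_space set \<Rightarrow> ('a \<Rightarrow> real) \<Rightarrow> bool" where
  "usc_on S f \<longleftrightarrow> (\<forall>c. openin (top_of_set S) {p\<in>S. f p < c})"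

lemma usc_on_subset:
  assumes "usc_on S f" "S' \<subseteq> S"
  shows "usc_on S' f"
  unfolding usc_on_def
proof
  fix c
  have "openin (top_of_set S) {p\<in>S. f p < c}" using assms(1) by (auto simp: usc_on_def)
  then obtain V where V: "open V" "{p\<in>S. f p < c} = S \<inter> V" by (auto simp: openin_open)
  have "{p\<in>S'. f p < c} = S' \<inter> V" using V(2) assms(2) by blast
  then show "openin (top_of_set S') {p\<in>S'. f p < c}" using V(1) by (auto simp: openin_open)
qed

lemma usc_on_compose:
  assumes "usc_on S f" "continuous_on X h" "h ` X \<subseteq> S"
  shows "usc_on X (\<lambda>q. f (h q))"
  unfolding usc_on_def
proof
  fix c
  have "openin (top_of_set X) (X \<inter> h -` {p\<in>S. f p < c})"
    using assms by (intro continuous_openin_preimage[where T = S]) (auto simp: usc_on_def)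
  moreover have "X \<inter> h -` {p\<in>S. f p < c} = {q\<in>X. f (h q) < c}" using assms(3) by auto
  ultimately show "openin (top_of_set X) {q\<in>X. f (h q) < c}" by simp
qed

lemma usc_on_continuous:
  assumes "continuous_on S f"
  shows "usc_on S f"
  unfolding usc_on_def
proof
  fix c
  have "openin (top_of_set S) (S \<inter> f -` {..<c})"
    by (rule continuous_openin_preimage_gen[OF assms]) simp
  moreover have "S \<inter> f -` {..<c} = {p\<in>S. f p < c}" by auto
  ultimately show "openin (top_of_set S) {p\<in>S. f p < c}" by simp
qed

lemma usc_on_add:
  assumes "usc_on S f" "usc_on S g"
  shows "usc_on S (\<lambda>p. f p + g p)"
  unfolding usc_on_def
proof
  fix c
  have "{p\<in>S. f p + g p < c} = (\<Union>r. {p\<in>S. f p < r} \<inter> {p\<in>S. g p < c - r})"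
  proof (intro set_eqI iffI)
    fix p assume "p \<in> {p\<in>S. f p + g p < c}"
    then have p: "p \<in> S" "f p < c - g p" by auto
    then obtain r where "f p < r" "r < c - g p" using dense by blast
    then show "p \<in> (\<Union>r. {p\<in>S. f p < r} \<inter> {p\<in>S. g p < c - r})" using p by auto
  qed auto
  moreover have "openin (top_of_set S) (\<Union>r. {p\<in>S. f p < r} \<inter> {p\<in>S. g p < c - r})"
    using assms by (auto simp: usc_on_def)
  ultimately show "openin (top_of_set S) {p\<in>S. f p + g p < c}" by simp
qed

lemma usc_on_diff:
  assumes "usc_on S f" "continuous_on S g"
  shows "usc_on S (\<lambda>p. f p - g p)"
  using usc_on_add[OF assms(1) usc_on_continuous[OF continuous_on_minus[OF assms(2)]]] by simp

text \<open>
  If no point were maximal, the open sets where \<open>f < f q\<close> would cover \<open>S\<close>. Among the finitely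
  many \<open>q\<close> of a subcover, one with the largest value \<open>f q\<close> lies in none of the sets.
\<close>

lemma usc_on_attains_max:
  assumes "compact S" "S \<noteq> {}" "usc_on S f"
  shows "\<exists>p\<in>S. \<forall>q\<in>S. f q \<le> f p"
proof (rule ccontr)
  assume "\<not> ?thesis"
  then have no: "\<forall>p\<in>S. \<exists>q\<in>S. f p < f q" by (meson not_le)
  have "\<forall>q. \<exists>V. open V \<and> {p\<in>S. f p < f q} = S \<inter> V"
    using assms(3) by (auto simp: usc_on_def openin_open)
  then obtain V where V: "\<And>q. open (V q)" "\<And>q. {p\<in>S. f p < f q} = S \<inter> V q" by metis
  have "S \<subseteq> (\<Union>q\<in>S. V q)" using no V(2) by blast
  then obtain Q where Q: "Q \<subseteq> S" "finite Q" "S \<subseteq> (\<Union>q\<in>Q. V q)"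
    using compactE_image[OF assms(1), of S V] V(1) by metis
  then have "Q \<noteq> {}" using assms(2) by auto
  define m where "m = Max (f ` Q)"
  have "m \<in> f ` Q" unfolding m_def using Q \<open>Q \<noteq> {}\<close> by (intro Max_in) auto
  then obtain p where p: "p \<in> Q" "f p = m" by auto
  then obtain q where "q \<in> Q" "p \<in> V q" using Q by blast
  then have "f p < f q" using V(2)[of q] p Q by blast
  moreover have "f q \<le> m" unfolding m_def using Q \<open>q \<in> Q\<close> by (intro Max_ge) auto
  ultimately show False using p by simp
qed

lemma usc_on_attains_max_outside:
  assumes "usc_on S f" "compact K" "K \<subseteq> S" "p0 \<in> K" "\<And>q. q \<in> S - K \<Longrightarrow> f q \<le> f p0"
  shows "\<exists>p\<in>K. \<forall>q\<in>S. f q \<le> f p"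
proof -
  obtain p where p: "p \<in> K" "\<forall>q\<in>K. f q \<le> f p"
    using usc_on_attains_max[OF assms(2) _ usc_on_subset[OF assms(1,3)]] assms(4) by blast
  have "f q \<le> f p" if "q \<in> S" for q
    using p assms(4) assms(5)[of q] that by (cases "q \<in> K") (auto intro: order_trans)
  then show ?thesis using p by blast
qed

lemma usc_on_eventually_less:
  assumes "usc_on S f" "p \<in> S" "f p < c"
  shows "\<exists>V. open V \<and> p \<in> V \<and> (\<forall>q\<in>V \<inter> S. f q < c)"
proof -
  obtain V where V: "open V" "{p\<in>S. f p < c} = S \<inter> V"
    using assms(1) by (auto simp: usc_on_def openin_open)
  then have "p \<in> V" "\<forall>q\<in>V \<inter> S. f q < c" using assms by auto
  then show ?thesis using V by blast
qed

lemma usc_on_limit_ge: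
  fixes P :: "nat \<Rightarrow> 'a::topological_space"
  assumes "usc_on S f" "p \<in> S" "P \<longlonglongrightarrow> p" "\<And>n. P n \<in> S" "b \<longlonglongrightarrow> c" "\<And>n. b n \<le> f (P n)"
  shows "c \<le> f p"
proof (rule ccontr)
  assume "\<not> c \<le> f p"
  then obtain d where d: "f p < d" "d < c" using dense not_le by blast
  obtain V where V: "open V" "p \<in> V" "\<forall>q\<in>V \<inter> S. f q < d"
    using usc_on_eventually_less[OF assms(1,2) d(1)] by blast
  have "\<forall>\<^sub>F n in sequentially. P n \<in> V" using assms(3) V by (auto simp: tendsto_def)
  moreover have "\<forall>\<^sub>F n in sequentially. d < b n" using assms(5) d(2) by (rule order_tendstoD(1))
  ultimately have "\<forall>\<^sub>F n in sequentially. False"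
  proof eventually_elim
    case (elim n)
    then have "f (P n) < d" using V assms(4) by blast
    then show False using elim assms(6)[of n] by linarith
  qed
  then show False by simp
qed

section \<open>Slopes at a boundary point\<close>

text \<open>
  The local shape at a boundary point \<open>(t0, 0)\<close> of a subsolution with time derivative \<open>- a\<close>:
  \<open>W \<tau> x\<close> stands for its increment from \<open>(t0, 0)\<close> to \<open>(t0 + \<tau>, x)\<close> minus a quadratic function of
  \<open>\<tau>\<close>. The assumptions \<open>inner\<close> and \<open>bdry\<close> are the viscosity inequalities for parabolas and
  lines in \<open>x\<close>. Time is kept as a variable, but \<open>side\<close> prevents maxima with value above
  \<open>- \<kappa>\<close> from reaching the ends of the time interval, so the profile can be treated as a
  function of \<open>x\<close> alone.
\<close>

locale boundary_profile =
  fixes H F :: "real \<Rightarrow> real" and a :: real and W :: "real \<Rightarrow> real \<Rightarrow> real" and r R \<kappa> :: real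
  assumes r: "0 < r" and R: "0 < R" and kappa: "0 < \<kappa>"
    and usc: "usc_on ({-r..r} \<times> {0..R}) (\<lambda>q. W (fst q) (snd q))"
    and Wle: "\<And>\<tau>. \<tau> \<in> {-r..r} \<Longrightarrow> W \<tau> 0 \<le> 0"
    and side: "\<And>\<tau> x. \<bar>\<tau>\<bar> = r \<Longrightarrow> x \<in> {0..R} \<Longrightarrow> W \<tau> x < -\<kappa>"
    and inner: "\<And>\<tau> x p k. \<bar>\<tau>\<bar> < r \<Longrightarrow> 0 < x \<Longrightarrow> x < R \<Longrightarrow>
        (\<forall>\<^sub>F q in at (\<tau>, x). W (fst q) (snd q) - p * snd q - k * (snd q)\<^sup>2 \<le> W \<tau> x - p * x - k * x\<^sup>2)
        \<Longrightarrow> H (p + 2 * k * x) \<le> a"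
    and bdry: "\<And>p \<rho>. 0 < \<rho> \<Longrightarrow> \<rho> \<le> R \<Longrightarrow> (\<forall>\<tau>\<in>{-r..r}. \<forall>x\<in>{0..\<rho>}. W \<tau> x \<le> p * x)
        \<Longrightarrow> H p \<le> a \<or> F p \<le> a"
begin

definition slopes :: "real set" where
  "slopes = {p. \<exists>\<rho>>0. \<rho> \<le> R \<and> (\<forall>\<tau>\<in>{-r..r}. \<forall>x\<in>{0..\<rho>}. W \<tau> x \<le> p * x)}"

lemma slopes_bdry: "p \<in> slopes \<Longrightarrow> H p \<le> a \<or> F p \<le> a"
  unfolding slopes_def using bdry by blast

lemma slopes_upward:
  assumes "p \<in> slopes" "p \<le> q"
  shows "q \<in> slopes"
proof -
  obtain \<rho> where \<rho>: "\<rho> > 0" "\<rho> \<le> R" "\<forall>\<tau>\<in>{-r..r}. \<forall>x\<in>{0..\<rho>}. W \<tau> x \<le> p * x"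
    using assms(1) by (auto simp: slopes_def)
  have "W \<tau> x \<le> q * x" if "\<tau>\<in>{-r..r}" "x\<in>{0..\<rho>}" for \<tau> x
  proof -
    have "W \<tau> x \<le> p * x" using \<rho> that by blast
    also have "\<dots> \<le> q * x" using assms(2) that by (intro mult_right_mono) auto
    finally show ?thesis .
  qed
  then show ?thesis using \<rho> by (auto simp: slopes_def)
qed

lemma not_slopesE:
  assumes "p \<notin> slopes" "0 < \<rho>"
  obtains \<tau> x where "\<tau> \<in> {-r..r}" "0 < x" "x \<le> \<rho>" "x < R" "W \<tau> x > p * x"
proof -
  define \<rho>' where "\<rho>' = min \<rho> (R/2)"
  have \<rho>': "0 < \<rho>'" "\<rho>' \<le> \<rho>" "\<rho>' < R" using assms(2) R by (auto simp: \<rho>'_def)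
  then obtain \<tau> x where "\<tau> \<in> {-r..r}" "x \<in> {0..\<rho>'}" "\<not> W \<tau> x \<le> p * x"
    using assms(1) unfolding slopes_def by force
  moreover from this have "x \<noteq> 0" using Wle[of \<tau>] by auto
  ultimately show ?thesis using that[of \<tau> x] \<rho>' by auto
qed

text \<open>
  The parabola \<open>p x + k x\<^sup>2\<close> is above \<open>W\<close> at \<open>x = 0\<close> and \<open>x = \<rho>\<close> but below it at one point
  between. So \<open>W\<close> minus the parabola has a positive maximum with \<open>0 < x < \<rho>\<close>, and
  \<open>\<bar>p\<bar> \<rho> < \<kappa>\<close> keeps it off the ends of the time interval.
\<close>

lemma interior_contact:
  assumes "0 \<le> k" "0 < \<rho>" "\<rho> \<le> R" "\<bar>p\<bar> * \<rho> < \<kappa>"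
    and top: "\<And>\<tau>. \<tau> \<in> {-r..r} \<Longrightarrow> W \<tau> \<rho> \<le> p * \<rho> + k * \<rho>\<^sup>2"
    and pos: "\<tau>2 \<in> {-r..r}" "0 \<le> x2" "x2 \<le> \<rho>" "W \<tau>2 x2 > p * x2 + k * x2\<^sup>2"
  shows "\<exists>x. 0 < x \<and> x < \<rho> \<and> H (p + 2 * k * x) \<le> a"
proof -
  let ?K = "{-r..r} \<times> {0..\<rho>}"
  let ?f = "\<lambda>q. W (fst q) (snd q) - p * snd q - k * (snd q)\<^sup>2"
  have "usc_on ?K (\<lambda>q. W (fst q) (snd q) - (p * snd q + k * (snd q)\<^sup>2))"
    using assms by (intro usc_on_diff usc_on_subset[OF usc] continuous_intros) auto
  then have u: "usc_on ?K ?f" by (simp add: algebra_simps)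
  have "compact ?K" by (intro compact_Times) auto
  moreover have "?K \<noteq> {}" using pos by auto
  ultimately obtain m where m: "m \<in> ?K" "\<forall>q\<in>?K. ?f q \<le> ?f m"
    using usc_on_attains_max[OF _ _ u] by blast
  obtain \<tau> x where mx: "m = (\<tau>, x)" by force
  have tx: "\<tau> \<in> {-r..r}" "0 \<le> x" "x \<le> \<rho>" using m mx by auto
  have "?f (\<tau>2, x2) \<le> ?f m" using m(2) pos by auto
  then have val: "W \<tau> x > p * x + k * x\<^sup>2" using pos mx by auto
  have "x \<noteq> 0" using val Wle[OF tx(1)] by auto
  moreover have "x \<noteq> \<rho>" using val top[OF tx(1)] by auto
  ultimately have x: "0 < x" "x < \<rho>" using tx by auto
  have "\<bar>\<tau>\<bar> \<noteq> r"
  proof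
    assume "\<bar>\<tau>\<bar> = r"
    then have "W \<tau> x < -\<kappa>" using side[of \<tau> x] tx assms by auto
    moreover have "- \<bar>p\<bar> * \<rho> \<le> p * x"
    proof -
      have "\<bar>p * x\<bar> \<le> \<bar>p\<bar> * \<rho>" using x by (auto simp: abs_mult intro!: mult_left_mono)
      then show ?thesis by (auto simp: abs_le_iff)
    qed
    moreover have "0 \<le> k * x\<^sup>2" using assms by simp
    ultimately show False using val assms(4) by linarith
  qed
  then have \<tau>: "\<bar>\<tau>\<bar> < r" using tx by auto
  have op: "open ({-r<..<r} \<times> {0<..<\<rho>})" by (intro open_Times) auto
  have "\<forall>\<^sub>F q in at (\<tau>, x). ?f q \<le> W \<tau> x - p * x - k * x\<^sup>2"
    unfolding eventually_at_topological
  proof (intro exI conjI ballI impI)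
    show "open ({-r<..<r} \<times> {0<..<\<rho>})" by (rule op)
    show "(\<tau>, x) \<in> {-r<..<r} \<times> {0<..<\<rho>}" using \<tau> x by auto
    fix q assume "q \<in> {-r<..<r} \<times> {0<..<\<rho>}"
    then have "q \<in> ?K" by auto
    then show "?f q \<le> W \<tau> x - p * x - k * x\<^sup>2" using m(2) mx by fastforce
  qed
  from inner[OF \<tau> x(1) _ this] x assms(3) show ?thesis by auto
qed

lemma small_radius:
  obtains \<rho>0 where "0 < \<rho>0" "\<rho>0 \<le> R" "\<And>\<rho>. 0 \<le> \<rho> \<Longrightarrow> \<rho> \<le> \<rho>0 \<Longrightarrow> \<bar>p\<bar> * \<rho> < \<kappa>"
proof -
  define \<rho>0 where "\<rho>0 = min R (\<kappa> / (\<bar>p\<bar> + 1))"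
  have "0 < \<rho>0" "\<rho>0 \<le> R" using R kappa by (auto simp: \<rho>0_def)
  moreover have "\<bar>p\<bar> * \<rho> < \<kappa>" if "0 \<le> \<rho>" "\<rho> \<le> \<rho>0" for \<rho>
  proof -
    have "\<bar>p\<bar> * \<rho> \<le> \<bar>p\<bar> * (\<kappa> / (\<bar>p\<bar> + 1))" using that by (intro mult_left_mono) (auto simp: \<rho>0_def)
    also have "\<dots> < \<kappa>" using kappa by (simp add: field_simps)
    finally show ?thesis .
  qed
  ultimately show ?thesis using that by blast
qed

text \<open>
  If \<open>W\<close> comes both above and below the line \<open>p x\<close> arbitrarily close to \<open>0\<close>, it exceeds the line
  somewhere between \<open>0\<close> and a point where it is below: this is an interior contact with \<open>k = 0\<close>.
\<close>

lemma straddled_slope: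
  assumes "p \<notin> slopes"
    and dip: "\<And>\<rho>. 0 < \<rho> \<Longrightarrow> \<exists>x. 0 < x \<and> x \<le> \<rho> \<and> (\<forall>\<tau>\<in>{-r..r}. W \<tau> x \<le> p * x)"
  shows "H p \<le> a"
proof -
  obtain \<rho>0 where \<rho>0: "0 < \<rho>0" "\<rho>0 \<le> R" "\<And>\<rho>. 0 \<le> \<rho> \<Longrightarrow> \<rho> \<le> \<rho>0 \<Longrightarrow> \<bar>p\<bar> * \<rho> < \<kappa>"
    using small_radius[of p] by blast
  obtain x1 where x1: "0 < x1" "x1 \<le> \<rho>0" "\<forall>\<tau>\<in>{-r..r}. W \<tau> x1 \<le> p * x1" using dip[OF \<rho>0(1)] by blast
  obtain \<tau> x where "\<tau> \<in> {-r..r}" "0 < x" "x \<le> x1" "x < R" "W \<tau> x > p * x"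
    using not_slopesE[OF assms(1) x1(1)] by blast
  then show ?thesis using interior_contact[of 0 x1 p \<tau> x] x1 \<rho>0 by auto
qed

text \<open>
  The infimum \<open>A\<close> of the touching slopes is itself an approximate contact slope in \<open>x > 0\<close>:
  near \<open>0\<close> the profile stays below \<open>(A + \<tau>) x\<close> but not below \<open>(A - \<tau> / 2) x\<close>, and a parabola of
  initial slope \<open>A - \<tau>\<close> that is bent up to meet \<open>(A + \<tau>) x\<close> at \<open>\<rho>\<close> has an interior contact with
  slope within \<open>3 \<tau>\<close> of \<open>A\<close>.
\<close>

lemma critical_slope:
  assumes "slopes \<noteq> {}" "bdd_below slopes" and H: "continuous_on UNIV H"
  shows "H (Inf slopes) \<le> a"
proof (rule ccontr)
  assume n: "\<not> ?thesis"
  define A where "A = Inf slopes"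
  have "open {p. a < H p}" using open_Collect_less[OF continuous_on_const H] .
  then obtain e where e: "e > 0" "\<And>q. dist q A < e \<Longrightarrow> a < H q"
    using n unfolding open_dist A_def by (metis mem_Collect_eq not_le)
  define \<tau> where "\<tau> = e / 5"
  have \<tau>: "\<tau> > 0" using e by (simp add: \<tau>_def)
  obtain q where "q \<in> slopes" "q < A + \<tau>"
    using assms(1,2) \<tau> cInf_less_iff[of slopes "A + \<tau>"] by (auto simp: A_def)
  then have up: "A + \<tau> \<in> slopes" using slopes_upward by force
  then obtain \<rho>1 where \<rho>1: "\<rho>1 > 0" "\<rho>1 \<le> R" "\<forall>\<sigma>\<in>{-r..r}. \<forall>x\<in>{0..\<rho>1}. W \<sigma> x \<le> (A + \<tau>) * x"
    by (auto simp: slopes_def)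
  have low: "A - \<tau>/2 \<notin> slopes"
  proof
    assume "A - \<tau>/2 \<in> slopes"
    then have "A \<le> A - \<tau>/2" unfolding A_def using assms(2) by (intro cInf_lower)
    then show False using \<tau> by simp
  qed
  let ?p = "A - \<tau>"
  obtain \<rho>0 where \<rho>0: "0 < \<rho>0" "\<rho>0 \<le> R" "\<And>\<rho>. 0 \<le> \<rho> \<Longrightarrow> \<rho> \<le> \<rho>0 \<Longrightarrow> \<bar>?p\<bar> * \<rho> < \<kappa>"
    using small_radius[of ?p] by blast
  define \<rho> where "\<rho> = min \<rho>0 \<rho>1"
  have \<rho>: "0 < \<rho>" "\<rho> \<le> R" "\<rho> \<le> \<rho>0" "\<rho> \<le> \<rho>1" using \<rho>0 \<rho>1 by (auto simp: \<rho>_def)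
  \<comment> \<open>With this \<open>k\<close> the parabola meets the line \<open>(A + \<tau>) x\<close> at \<open>\<rho>\<close>; its excess \<open>k x\<^sup>2\<close> over its initial
    tangent is at most \<open>\<tau> x / 2\<close> for \<open>x \<le> \<rho> / 4\<close>.\<close>
  define k where "k = 2 * \<tau> / \<rho>"
  have k: "k > 0" "k * \<rho> = 2 * \<tau>" using \<rho> \<tau> by (auto simp: k_def)
  obtain \<sigma> x where x: "\<sigma> \<in> {-r..r}" "0 < x" "x \<le> min \<rho> (\<rho>/4)" "x < R" "W \<sigma> x > (A - \<tau>/2) * x"
    using not_slopesE[OF low, of "min \<rho> (\<rho>/4)"] \<rho> by auto
  have "k * x \<le> k * (\<rho>/4)" using x k by (intro mult_left_mono) auto
  then have "k * x \<le> \<tau>/2" using k by simp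
  then have "(k * x) * x \<le> (\<tau>/2) * x" using x by (intro mult_right_mono) auto
  then have "W \<sigma> x > ?p * x + k * x\<^sup>2" using x(5) by (simp add: algebra_simps power2_eq_square)
  moreover have "W \<sigma> \<rho> \<le> ?p * \<rho> + k * \<rho>\<^sup>2" if "\<sigma> \<in> {-r..r}" for \<sigma>
  proof -
    have "W \<sigma> \<rho> \<le> (A + \<tau>) * \<rho>" using \<rho>1(3) that \<rho> by auto
    also have "\<dots> = ?p * \<rho> + (k * \<rho>) * \<rho>" unfolding k(2) by (simp add: algebra_simps)
    finally show ?thesis by (simp add: power2_eq_square)
  qed
  ultimately obtain y where y: "0 < y" "y < \<rho>" "H (?p + 2 * k * y) \<le> a"
    using interior_contact[of k \<rho> ?p \<sigma> x] k \<rho> \<rho>0(3)[of \<rho>] x by auto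
  have "k * y < k * \<rho>" using y k(1) by simp
  then have "0 < k * y" "k * y < 2 * \<tau>" using k y(1) by (simp_all only: k(2) mult_pos_pos)
  then have "dist (?p + 2 * k * y) A < e" using \<tau> e(1) by (auto simp: dist_real_def \<tau>_def abs_if)
  then show False using e(2) y(3) by force
qed

text \<open>
  When no line lies above \<open>W\<close>, the profile rises infinitely fast at \<open>0\<close>. It is bounded, so a
  parabola of arbitrary initial slope \<open>P\<close> bent up strongly enough is above it at \<open>\<rho>\<close> and
  still below it somewhere nearer to \<open>0\<close>; contacts have slope at least \<open>P\<close>.
\<close>

lemma no_slopes:
  assumes "slopes = {}"
  shows "\<exists>p\<ge>P. H p \<le> a"
proof -
  let ?K = "{-r..r} \<times> {0..R}"
  have "compact ?K" by (intro compact_Times) auto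
  moreover have "?K \<noteq> {}" using r R by auto
  ultimately obtain m where m: "\<forall>q\<in>?K. W (fst q) (snd q) \<le> W (fst m) (snd m)"
    using usc_on_attains_max[OF _ _ usc] by blast
  define M where "M = \<bar>W (fst m) (snd m)\<bar>"
  have M: "W \<tau> x \<le> M" if "\<tau> \<in> {-r..r}" "x \<in> {0..R}" for \<tau> x using m that by (force simp: M_def)
  obtain \<rho> where \<rho>: "0 < \<rho>" "\<rho> \<le> R" "\<bar>P\<bar> * \<rho> < \<kappa>" using small_radius[of P] by (metis less_imp_le order_refl)
  \<comment> \<open>Makes the parabola exceed the bound \<open>M\<close> of the profile at \<open>\<rho>\<close>.\<close>
  define k where "k = (M + \<bar>P\<bar> * \<rho> + 1) / \<rho>\<^sup>2"
  have k: "k > 0" "k * \<rho>\<^sup>2 = M + \<bar>P\<bar> * \<rho> + 1" using \<rho> by (auto simp: k_def M_def intro!: divide_pos_pos add_nonneg_pos)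
  obtain \<sigma> x where x: "\<sigma> \<in> {-r..r}" "0 < x" "x \<le> min \<rho> (1/k)" "x < R" "W \<sigma> x > (P + 1) * x"
    using not_slopesE[of "P + 1" "min \<rho> (1/k)"] \<rho> k assms by auto
  have "k * x \<le> k * (1/k)" using x k by (intro mult_left_mono) auto
  then have "(k * x) * x \<le> 1 * x" using x k by (intro mult_right_mono) auto
  then have "W \<sigma> x > P * x + k * x\<^sup>2" using x(5) by (simp add: algebra_simps power2_eq_square)
  moreover have "W \<sigma> \<rho> \<le> P * \<rho> + k * \<rho>\<^sup>2" if "\<sigma> \<in> {-r..r}" for \<sigma>
  proof -
    have "- \<bar>P\<bar> * \<rho> \<le> P * \<rho>" using \<rho> by (intro mult_right_mono) auto
    then show ?thesis using M[OF that, of \<rho>] \<rho> k by auto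
  qed
  ultimately obtain y where y: "0 < y" "y < \<rho>" "H (P + 2 * k * y) \<le> a"
    using interior_contact[of k \<rho> P \<sigma> x] k \<rho> x by auto
  then show ?thesis using k by (intro exI[of _ "P + 2 * k * y"]) auto
qed

end

lemma (in boundary_profile) above_Inf_slopes:
  assumes "slopes \<noteq> {}" "bdd_below slopes" "Inf slopes < q"
  shows "q \<in> slopes"
proof -
  obtain p where "p \<in> slopes" "p < q" using cInf_less_iff[OF assms(1,2)] assms(3) by blast
  then show ?thesis using slopes_upward[of p q] by simp
qed

text \<open>
  \<open>W\<close> is the profile of a subsolution and \<open>- Z\<close> that of a supersolution above it, written as a
  reflected subsolution: \<open>- p\<close> is a slope of \<open>Z\<close> when the line \<open>p x\<close> touches \<open>- Z\<close> from below.
  The slopes touching \<open>W\<close> from above and those touching \<open>- Z\<close> from below cover the real line,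
  \<open>H\<close> is at most \<open>a\<close> at the lower end of the former and at least \<open>b\<close> at the upper end of the latter,
  and at an intermediate slope where \<open>H\<close> is between \<open>a\<close> and \<open>b\<close> both boundary inequalities for \<open>F\<close>
  hold, which is impossible.
\<close>

lemma boundary_profiles_contradiction:
  fixes H F :: "real \<Rightarrow> real"
  assumes H: "continuous_on UNIV H"
    and Fbot: "filterlim F at_top at_bot"
    and alt: "filterlim F at_bot at_top \<or> filterlim H at_top at_infinity"
    and ab: "a < b"
    and W: "boundary_profile H F a W r R \<kappa>"
    and Z: "boundary_profile (\<lambda>p. - H (- p)) (\<lambda>p. - F (- p)) (- b) Z r' R' \<kappa>'"
    and le: "\<And>\<tau> \<tau>' x. \<tau> \<in> {-r..r} \<Longrightarrow> \<tau>' \<in> {-r'..r'} \<Longrightarrow> 0 \<le> x \<Longrightarrow> x \<le> R \<Longrightarrow> x \<le> R' \<Longrightarrow> W \<tau> x + Z \<tau>' x \<le> 0"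
  shows False
proof -
  interpret W: boundary_profile H F a W r R \<kappa> by (rule W)
  interpret Z: boundary_profile "\<lambda>p. - H (- p)" "\<lambda>p. - F (- p)" "- b" Z r' R' \<kappa>' by (rule Z)
  have H': "continuous_on UNIV (\<lambda>p. - H (- p))"
    by (intro continuous_intros continuous_on_compose2[OF H]) auto
  have cover: "p \<in> W.slopes \<or> - p \<in> Z.slopes" for p
  proof (rule ccontr)
    assume "\<not> ?thesis"
    then have nW: "p \<notin> W.slopes" and nZ: "- p \<notin> Z.slopes" by auto
    have "H p \<le> a"
    proof (rule W.straddled_slope[OF nW])
      fix \<rho> :: real assume "0 < \<rho>"
      then obtain \<tau>' x where x: "\<tau>' \<in> {-r'..r'}" "0 < x" "x \<le> min \<rho> R" "x < R'" "Z \<tau>' x > - p * x"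
        using Z.not_slopesE[OF nZ, of "min \<rho> R"] W.R by auto
      then have "\<forall>\<tau>\<in>{-r..r}. W \<tau> x \<le> p * x" using le[OF _ x(1), of _ x] by force
      then show "\<exists>x. 0 < x \<and> x \<le> \<rho> \<and> (\<forall>\<tau>\<in>{-r..r}. W \<tau> x \<le> p * x)" using x by auto
    qed
    moreover have "- H (- (- p)) \<le> - b"
    proof (rule Z.straddled_slope[OF nZ])
      fix \<rho> :: real assume "0 < \<rho>"
      then obtain \<tau> x where x: "\<tau> \<in> {-r..r}" "0 < x" "x \<le> min \<rho> R'" "x < R" "W \<tau> x > p * x"
        using W.not_slopesE[OF nW, of "min \<rho> R'"] Z.R by auto
      then have "\<forall>\<tau>'\<in>{-r'..r'}. Z \<tau>' x \<le> - p * x" using le[OF x(1), of _ x] by force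
      then show "\<exists>x. 0 < x \<and> x \<le> \<rho> \<and> (\<forall>\<tau>'\<in>{-r'..r'}. Z \<tau>' x \<le> - p * x)" using x by auto
    qed
    ultimately show False using ab by simp
  qed
  \<comment> \<open>When all lines touch, the boundary alternative \<open>F p \<le> a\<close> (or \<open>F p \<ge> b\<close>) fails for extreme
    slopes, which leaves the inequality for \<open>H\<close>. Coercivity of \<open>H\<close> gives \<open>high\<close> outright.\<close>
  have low: "\<exists>N. \<forall>p\<le>N. H p \<le> a" if all: "W.slopes = UNIV"
  proof -
    have "\<forall>\<^sub>F p in at_bot. a < F p" using Fbot by (simp add: filterlim_at_top_dense)
    then obtain N where "\<forall>p\<le>N. a < F p" by (auto simp: eventually_at_bot_linorder)
    then show ?thesis using W.slopes_bdry all by (metis UNIV_I not_le)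
  qed
  have high: "\<exists>N. \<forall>p\<ge>N. b \<le> H p" if all: "Z.slopes = UNIV"
    using alt
  proof
    assume "filterlim F at_bot at_top"
    then have "\<forall>\<^sub>F p in at_top. F p < b" by (simp add: filterlim_at_bot_dense)
    then obtain N where N: "\<forall>p\<ge>N. F p < b" by (auto simp: eventually_at_top_linorder)
    have "b \<le> H p" if "p \<ge> N" for p
      using Z.slopes_bdry[of "- p"] all N that by force
    then show ?thesis by blast
  next
    assume "filterlim H at_top at_infinity"
    then have "\<forall>\<^sub>F p in at_infinity. b \<le> H p" by (simp add: filterlim_at_top)
    then obtain N where "\<forall>p. N \<le> norm p \<longrightarrow> b \<le> H p" by (auto simp: eventually_at_infinity)
    then show ?thesis by (intro exI[of _ N]) auto
  qed
  \<comment> \<open>If one set of slopes is empty the other is everything, while \<open>no_slopes\<close> provides an extreme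
    slope with the opposite inequality for \<open>H\<close>.\<close>
  have neW: "W.slopes \<noteq> {}"
  proof
    assume e: "W.slopes = {}"
    have "q \<in> Z.slopes" for q using cover[of "- q"] e by auto
    then obtain N where "\<forall>p\<ge>N. b \<le> H p" using high by auto
    moreover obtain p where "p \<ge> N" "H p \<le> a" using W.no_slopes[OF e] by blast
    ultimately show False using ab by force
  qed
  have neZ: "Z.slopes \<noteq> {}"
  proof
    assume e: "Z.slopes = {}"
    have "W.slopes = UNIV" using cover e by auto
    then obtain N where "\<forall>p\<le>N. H p \<le> a" using low by auto
    moreover obtain p where "p \<ge> - N" "- H (- p) \<le> - b" using Z.no_slopes[OF e] by blast
    ultimately have "b \<le> H (- p)" "H (- p) \<le> a" by auto
    then show False using ab by simp
  qed
  have highZ: "\<exists>q. b \<le> H q \<and> q \<ge> P \<and> (\<forall>p<q. - p \<in> Z.slopes)" if "\<not> bdd_below Z.slopes" for P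
  proof -
    have all: "q \<in> Z.slopes" for q
      using that Z.slopes_upward unfolding bdd_below_def by (metis linear)
    then obtain N where "\<forall>p\<ge>N. b \<le> H p" using high by auto
    then show ?thesis using all by (intro exI[of _ "max N P"]) auto
  qed
  have lowW: "\<exists>p. H p \<le> a \<and> p \<le> P \<and> (\<forall>q>p. q \<in> W.slopes)" if "\<not> bdd_below W.slopes" for P
  proof -
    have all: "q \<in> W.slopes" for q
      using that W.slopes_upward unfolding bdd_below_def by (metis linear)
    then have "W.slopes = UNIV" by auto
    then obtain N where "\<forall>p\<le>N. H p \<le> a" using low by auto
    then show ?thesis using all by (intro exI[of _ "min N P"]) auto
  qed
  have endpoints: "\<exists>p q. p \<le> q \<and> H p \<le> a \<and> b \<le> H q \<and> (\<forall>s>p. s \<in> W.slopes) \<and> (\<forall>s<q. - s \<in> Z.slopes)"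
  proof -
    have critW: "H (Inf W.slopes) \<le> a \<and> (\<forall>s>Inf W.slopes. s \<in> W.slopes)" if "bdd_below W.slopes"
      using W.critical_slope[OF neW that H] W.above_Inf_slopes[OF neW that] by blast
    have critZ: "b \<le> H (- Inf Z.slopes) \<and> (\<forall>s. s < - Inf Z.slopes \<longrightarrow> - s \<in> Z.slopes)"
      if bz: "bdd_below Z.slopes"
    proof (intro conjI allI impI)
      show "b \<le> H (- Inf Z.slopes)" using Z.critical_slope[OF neZ bz H'] by linarith
      show "- s \<in> Z.slopes" if "s < - Inf Z.slopes" for s
        using Z.above_Inf_slopes[OF neZ bz, of "- s"] that by linarith
    qed
    consider "\<not> bdd_below W.slopes" "\<not> bdd_below Z.slopes" | "bdd_below W.slopes" "\<not> bdd_below Z.slopes"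
      | "\<not> bdd_below W.slopes" "bdd_below Z.slopes" | "bdd_below W.slopes" "bdd_below Z.slopes" by metis
    then show ?thesis
    proof cases
      case 1
      then show ?thesis using lowW[of 0] highZ[of 0] by (metis order_trans)
    next
      case 2
      then show ?thesis using critW highZ[of "Inf W.slopes"] by metis
    next
      case 3
      then show ?thesis using critZ lowW[of "- Inf Z.slopes"] by metis
    next
      case 4
      have "Inf W.slopes \<le> - Inf Z.slopes"
      proof (rule ccontr)
        assume "\<not> ?thesis"
        then obtain s where s: "- Inf Z.slopes < s" "s < Inf W.slopes" using dense by (meson not_le)
        have "s \<notin> W.slopes" using s 4 cInf_lower not_le by blast
        moreover have "- s \<notin> Z.slopes" using s 4 cInf_lower[of "- s" Z.slopes] by auto
        ultimately show False using cover by blast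
      qed
      then show ?thesis using critW[OF 4(1)] critZ[OF 4(2)] by metis
    qed
  qed
  then obtain p q where pq: "p \<le> q" "H p \<le> a" "b \<le> H q" "\<forall>s>p. s \<in> W.slopes" "\<forall>s<q. - s \<in> Z.slopes"
    by blast
  obtain c where c: "a < c" "c < b" using dense ab by blast
  obtain s where s: "p \<le> s" "s \<le> q" "H s = c"
    using IVT'[of H p c q] pq c continuous_on_subset[OF H] by auto
  then have "p < s" "s < q" using pq c by (auto simp: less_le)
  then have "s \<in> W.slopes" "- s \<in> Z.slopes" using pq by auto
  then have "F s \<le> a" "b \<le> F s" using W.slopes_bdry[of s] Z.slopes_bdry[of "- s"] s c by auto
  then show False using ab by simp
qed

section \<open>Envelopes and viscosity inequalities\<close>

lemma usc_env_ge: "p \<in> S \<Longrightarrow> ereal (u p) \<le> usc_env S u p"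
proof (rule ccontr)
  assume p: "p \<in> S" and "\<not> ereal (u p) \<le> usc_env S u p"
  then have "Limsup (inf (nhds p) (principal S)) (\<lambda>q. ereal (u q)) < ereal (u p)"
    by (simp add: usc_env_def)
  then have "\<forall>\<^sub>F q in inf (nhds p) (principal S). ereal (u q) < ereal (u p)" by (rule Limsup_lessD)
  then have "\<forall>\<^sub>F q in nhds p. q \<in> S \<longrightarrow> u q < u p" by (simp add: eventually_inf_principal)
  then have "p \<in> S \<longrightarrow> u p < u p" by (rule eventually_nhds_x_imp_x)
  then show False using p by simp
qed

lemma usc_env_le:
  assumes "open V" "p \<in> V" "\<And>q. q \<in> V \<inter> S \<Longrightarrow> u q \<le> c"
  shows "usc_env S u p \<le> ereal c"
  unfolding usc_env_def
proof (rule Limsup_bounded)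
  show "\<forall>\<^sub>F q in inf (nhds p) (principal S). ereal (u q) \<le> ereal c"
    using assms by (auto simp: eventually_inf_principal eventually_nhds)
qed

lemma real_usc_env:
  assumes "locally_bounded_on S u" "p \<in> S"
  shows "ereal (real_of_ereal (usc_env S u p)) = usc_env S u p"
proof -
  obtain V where V: "open V" "p \<in> V" "bounded (u ` (V \<inter> S))"
    using assms by (auto simp: locally_bounded_on_def)
  then obtain B where "\<And>q. q \<in> V \<inter> S \<Longrightarrow> u q \<le> B" by (force simp: bounded_iff abs_le_iff)
  then have "usc_env S u p \<le> ereal B" by (intro usc_env_le[OF V(1,2)])
  moreover have "ereal (u p) \<le> usc_env S u p" using assms(2) by (rule usc_env_ge)
  ultimately show ?thesis by (cases "usc_env S u p") auto
qed

lemma usc_on_usc_env: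
  assumes "locally_bounded_on S u"
  shows "usc_on S (\<lambda>p. real_of_ereal (usc_env S u p))"
  unfolding usc_on_def
proof
  fix c
  let ?U = "\<lambda>p. real_of_ereal (usc_env S u p)"
  show "openin (top_of_set S) {p\<in>S. ?U p < c}"
  proof (subst openin_subopen, intro ballI)
    fix p assume p: "p \<in> {p\<in>S. ?U p < c}"
    then obtain d where d: "?U p < d" "d < c" using dense by blast
    have "ereal (?U p) < ereal d" using d by simp
    then have "usc_env S u p < ereal d" by (subst (asm) real_usc_env[OF assms]) (use p in auto)
    then have "\<forall>\<^sub>F q in inf (nhds p) (principal S). ereal (u q) < ereal d"
      unfolding usc_env_def by (rule Limsup_lessD)
    then obtain V where V: "open V" "p \<in> V" "\<And>q. q \<in> V \<inter> S \<Longrightarrow> u q < d"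
      by (auto simp: eventually_inf_principal eventually_nhds)
    have "?U q < c" if q: "q \<in> V \<inter> S" for q
    proof -
      have "usc_env S u q \<le> ereal d" using V q by (intro usc_env_le[of V]) (auto intro: less_imp_le)
      then have "ereal (?U q) \<le> ereal d" by (subst real_usc_env[OF assms]) (use q in auto)
      then show ?thesis using d by simp
    qed
    then show "\<exists>W. openin (top_of_set S) W \<and> p \<in> W \<and> W \<subseteq> {p\<in>S. ?U p < c}"
      using V p by (intro exI[of _ "S \<inter> V"]) (auto simp: openin_open)
  qed
qed

text \<open>
  The subsolution inequalities with margin \<open>m\<close>, restricted to test functions \<open>f t + g x\<close>: the
  barriers and penalties below are all of this form. With separated variables the derivatives are
  ordinary ones, and \<open>g\<close> may be required to be differentiable at \<open>0\<close> from both sides. The real-valued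
  \<open>G\<close> stands for an envelope.
\<close>

definition strict_visc_sub ::
  "real \<Rightarrow> (real \<Rightarrow> real) \<Rightarrow> (real \<Rightarrow> real) \<Rightarrow> real \<Rightarrow> (real \<times> real \<Rightarrow> real) \<Rightarrow> bool" where
  "strict_visc_sub T H F m G \<longleftrightarrow>
     (\<forall>f f' g g' t x.
        (\<forall>s\<in>{0<..<T}. (f has_real_derivative f' s) (at s)) \<longrightarrow> continuous_on {0<..<T} f' \<longrightarrow>
        (\<forall>y\<in>{0..}. (g has_real_derivative g' y) (at y)) \<longrightarrow> continuous_on {0..} g' \<longrightarrow>
        0 < t \<longrightarrow> t < T \<longrightarrow> 0 \<le> x \<longrightarrow>
        (\<forall>\<^sub>F q in at (t, x) within dom_pos T. G q - f (fst q) - g (snd q) \<le> G (t, x) - f t - g x) \<longrightarrow>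
        f' t + m + H (g' x) \<le> 0 \<or> x = 0 \<and> f' t + m + F (g' x) \<le> 0)"

lemma strict_visc_subD:
  assumes "strict_visc_sub T H F m G"
    and "\<And>s. 0 < s \<Longrightarrow> s < T \<Longrightarrow> (f has_real_derivative f' s) (at s)" "continuous_on {0<..<T} f'"
    and "\<And>y. 0 \<le> y \<Longrightarrow> (g has_real_derivative g' y) (at y)" "continuous_on {0..} g'"
    and "0 < t" "t < T" "0 \<le> x"
    and "\<forall>\<^sub>F q in at (t, x) within dom_pos T. G q - f (fst q) - g (snd q) \<le> G (t, x) - f t - g x"
  shows "f' t + m + H (g' x) \<le> 0 \<or> x = 0 \<and> f' t + m + F (g' x) \<le> 0"
  using assms(1)[unfolded strict_visc_sub_def, THEN spec, of f, THEN spec, of f', THEN spec, of g,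
      THEN spec, of g', THEN spec, of t, THEN spec, of x] assms(2-) by simp

lemma separable_C1_test:
  assumes f: "\<And>s. s \<in> {0<..<T} \<Longrightarrow> (f has_real_derivative f' s) (at s)" "continuous_on {0<..<T} f'"
    and g: "\<And>y. y \<in> {0..} \<Longrightarrow> (g has_real_derivative g' y) (at y)" "continuous_on {0..} g'"
  shows "C1_test_on (dom_pos T) (\<lambda>q. f (fst q) + g (snd q)) (\<lambda>q. f' (fst q)) (\<lambda>q. g' (snd q))"
  unfolding C1_test_on_def
proof (intro conjI ballI)
  fix p assume p: "p \<in> dom_pos T"
  have "(f has_derivative (\<lambda>h. f' (fst p) * h)) (at (fst p))"
    using f(1)[of "fst p"] p by (auto simp: dom_pos_def has_field_derivative_def)
  then have 1: "((\<lambda>q. f (fst q)) has_derivative (\<lambda>q. f' (fst p) * fst q)) (at p within dom_pos T)"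
    by (rule has_derivative_compose[OF has_derivative_fst[OF has_derivative_ident]])
  have "(g has_derivative (\<lambda>h. g' (snd p) * h)) (at (snd p))"
    using g(1)[of "snd p"] p by (auto simp: dom_pos_def has_field_derivative_def)
  then have 2: "((\<lambda>q. g (snd q)) has_derivative (\<lambda>q. g' (snd p) * snd q)) (at p within dom_pos T)"
    by (rule has_derivative_compose[OF has_derivative_snd[OF has_derivative_ident]])
  show "((\<lambda>q. f (fst q) + g (snd q)) has_derivative (\<lambda>(h, k). f' (fst p) * h + g' (snd p) * k)) (at p within dom_pos T)"
    using has_derivative_add[OF 1 2] by (simp add: case_prod_beta')
next
  show "continuous_on (dom_pos T) (\<lambda>q. f' (fst q))" "continuous_on (dom_pos T) (\<lambda>q. g' (snd q))"
    by (rule continuous_on_compose2[OF f(2)] continuous_on_compose2[OF g(2)];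
        auto simp: dom_pos_def intro: continuous_on_fst continuous_on_snd continuous_on_id)+
qed

lemma relaxed_subsolution_visc:
  assumes "relaxed_subsolution T H F u0 u"
  shows "strict_visc_sub T H F 0 (\<lambda>p. real_of_ereal (usc_env (dom_init T) u p))"
  unfolding strict_visc_sub_def
proof (intro allI impI)
  let ?U = "\<lambda>p. real_of_ereal (usc_env (dom_init T) u p)"
  fix f f' g g' t x
  assume f: "\<forall>s\<in>{0<..<T}. (f has_real_derivative f' s) (at s)" "continuous_on {0<..<T} f'"
    and g: "\<forall>y\<in>{0..}. (g has_real_derivative g' y) (at y)" "continuous_on {0..} g'"
    and tx: "0 < t" "t < T" "0 \<le> x"
    and top: "\<forall>\<^sub>F q in at (t, x) within dom_pos T. ?U q - f (fst q) - g (snd q) \<le> ?U (t, x) - f t - g x"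
  let ?\<phi> = "\<lambda>q. f (fst q) + g (snd q)"
  have lb: "locally_bounded_on (dom_init T) u" using assms by (simp add: relaxed_subsolution_def)
  have sub: "dom_pos T \<subseteq> dom_init T" by (auto simp: dom_pos_def dom_init_def)
  have p: "(t, x) \<in> dom_pos T" using tx by (simp add: dom_pos_def)
  have C1: "C1_test_on (dom_pos T) ?\<phi> (\<lambda>q. f' (fst q)) (\<lambda>q. g' (snd q))"
    using f g by (intro separable_C1_test) auto
  have "\<forall>\<^sub>F q in at (t, x) within dom_pos T. q \<in> dom_pos T" by (simp add: eventually_at_filter)
  with top have touch: "touches_from_above (dom_pos T) ?\<phi> (usc_env (dom_init T) u) (t, x)"
    unfolding touches_from_above_def
  proof eventually_elim
    case (elim q)
    have q: "q \<in> dom_init T" and p': "(t, x) \<in> dom_init T" using elim(2) p sub by blast+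
    have "ereal (?U q) - ereal (f (fst q) + g (snd q)) \<le> ereal (?U (t, x)) - ereal (f t + g x)"
      using elim(1) by simp
    then show ?case unfolding real_usc_env[OF lb q] real_usc_env[OF lb p'] by simp
  qed
  have "C1_test_on (dom_pos T) \<phi> \<phi>t \<phi>x \<longrightarrow> (t, x) \<in> dom_pos T \<longrightarrow>
      touches_from_above (dom_pos T) \<phi> (usc_env (dom_init T) u) (t, x) \<longrightarrow>
      (x > 0 \<longrightarrow> \<phi>t (t, x) + H (\<phi>x (t, x)) \<le> 0) \<and>
      (x = 0 \<longrightarrow> \<phi>t (t, x) + H (\<phi>x (t, x)) \<le> 0 \<or> \<phi>t (t, x) + F (\<phi>x (t, x)) \<le> 0)" for \<phi> \<phi>t \<phi>x
    using assms unfolding relaxed_subsolution_def by blast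
  from this[of ?\<phi> "\<lambda>q. f' (fst q)" "\<lambda>q. g' (snd q)"] C1 p touch
  have "(x > 0 \<longrightarrow> f' t + H (g' x) \<le> 0) \<and> (x = 0 \<longrightarrow> f' t + H (g' x) \<le> 0 \<or> f' t + F (g' x) \<le> 0)"
    by simp
  then show "f' t + 0 + H (g' x) \<le> 0 \<or> x = 0 \<and> f' t + 0 + F (g' x) \<le> 0"
    using tx by (cases "x = 0") auto
qed

lemma reflect_supersolution:
  assumes "relaxed_supersolution T H F u0 v"
  shows "relaxed_subsolution T (\<lambda>p. - H (- p)) (\<lambda>p. - F (- p)) (\<lambda>x. - u0 x) (\<lambda>p. - v p)"
  unfolding relaxed_subsolution_def
proof (intro conjI allI impI)
  have env: "usc_env S (\<lambda>p. - v p) p = - lsc_env S v p" for S p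
    unfolding usc_env_def lsc_env_def ereal_Limsup_uminus[symmetric] by simp
  have "bounded ((\<lambda>p. - v p) ` X) \<longleftrightarrow> bounded (v ` X)" for X
    by (simp add: bounded_iff)
  then show "locally_bounded_on (dom_init T) (\<lambda>p. - v p)"
    using assms by (simp add: relaxed_supersolution_def locally_bounded_on_def)
  fix x :: real
  show "usc_env (dom_init T) (\<lambda>p. - v p) (0, x) \<le> ereal (- u0 x)" if "0 \<le> x"
    unfolding env using assms that
    by (simp add: relaxed_supersolution_def flip: uminus_ereal.simps(1))
  fix \<phi> \<phi>t \<phi>x :: "real \<times> real \<Rightarrow> real" and t
  assume C1: "C1_test_on (dom_pos T) \<phi> \<phi>t \<phi>x" and p: "(t, x) \<in> dom_pos T"
    and top: "touches_from_above (dom_pos T) \<phi> (usc_env (dom_init T) (\<lambda>p. - v p)) (t, x)"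
  have C1': "C1_test_on (dom_pos T) (\<lambda>q. - \<phi> q) (\<lambda>q. - \<phi>t q) (\<lambda>q. - \<phi>x q)"
    unfolding C1_test_on_def
  proof (intro conjI ballI)
    fix q assume "q \<in> dom_pos T"
    then have "(\<phi> has_derivative (\<lambda>(h, k). \<phi>t q * h + \<phi>x q * k)) (at q within dom_pos T)"
      using C1 by (simp add: C1_test_on_def)
    from has_derivative_minus[OF this]
    show "((\<lambda>q. - \<phi> q) has_derivative (\<lambda>(h, k). - \<phi>t q * h + - \<phi>x q * k)) (at q within dom_pos T)"
      by (simp add: case_prod_beta')
  qed (use C1 in \<open>simp_all add: C1_test_on_def continuous_on_minus\<close>)
  have flip: "(- a - ereal r \<le> - b - ereal s) = (b - ereal (- s) \<le> a - ereal (- r))" for a b :: ereal and r s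
    by (cases a; cases b) auto
  have "touches_from_below (dom_pos T) (\<lambda>q. - \<phi> q) (lsc_env (dom_init T) v) (t, x)"
    using top unfolding touches_from_above_def touches_from_below_def env flip .
  then have *: "(x > 0 \<longrightarrow> - \<phi>t (t, x) + H (- \<phi>x (t, x)) \<ge> 0) \<and>
      (x = 0 \<longrightarrow> - \<phi>t (t, x) + H (- \<phi>x (t, x)) \<ge> 0 \<or> - \<phi>t (t, x) + F (- \<phi>x (t, x)) \<ge> 0)"
    using assms C1' p unfolding relaxed_supersolution_def by blast
  then show "\<phi>t (t, x) + - H (- \<phi>x (t, x)) \<le> 0" if "0 < x" using that by simp
  show "\<phi>t (t, x) + - H (- \<phi>x (t, x)) \<le> 0 \<or> \<phi>t (t, x) + - F (- \<phi>x (t, x)) \<le> 0" if "x = 0" using that * by auto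
qed

text \<open>
  The penalty contributes its time derivative \<open>\<sigma> / (T - t)\<^sup>2 \<ge> \<sigma> / T\<^sup>2\<close>, which becomes the margin,
  and its blow-up at \<open>T\<close> keeps maxima away from the final time.
\<close>

lemma penalised_visc_sub:
  assumes "strict_visc_sub T H F 0 U" "0 < \<sigma>"
  shows "strict_visc_sub T H F (\<sigma> / T\<^sup>2) (\<lambda>q. U q - \<sigma> / (T - fst q))"
  unfolding strict_visc_sub_def
proof (intro allI impI)
  fix f f' g g' t x
  assume f: "\<forall>s\<in>{0<..<T}. (f has_real_derivative f' s) (at s)" "continuous_on {0<..<T} f'"
    and g: "\<forall>y\<in>{0..}. (g has_real_derivative g' y) (at y)" "continuous_on {0..} g'"
    and tx: "0 < t" "t < T" "0 \<le> x"
    and top: "\<forall>\<^sub>F q in at (t, x) within dom_pos T. U q - \<sigma> / (T - fst q) - f (fst q) - g (snd q)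
      \<le> U (t, x) - \<sigma> / (T - fst (t, x)) - f t - g x"
  have "f' t + \<sigma> / (T - t)\<^sup>2 + 0 + H (g' x) \<le> 0 \<or> x = 0 \<and> f' t + \<sigma> / (T - t)\<^sup>2 + 0 + F (g' x) \<le> 0"
  proof (rule strict_visc_subD[OF assms(1), where f = "\<lambda>s. f s + \<sigma> / (T - s)"
        and f' = "\<lambda>s. f' s + \<sigma> / (T - s)\<^sup>2" and g = g])
    fix s assume s: "0 < s" "s < T"
    have "((\<lambda>s. \<sigma> / (T - s)) has_real_derivative \<sigma> / (T - s)\<^sup>2) (at s)"
      using s by (auto intro!: derivative_eq_intros simp: power2_eq_square)
    then show "((\<lambda>s. f s + \<sigma> / (T - s)) has_real_derivative f' s + \<sigma> / (T - s)\<^sup>2) (at s)"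
      using f(1) s by (intro DERIV_add) auto
  next
    show "continuous_on {0<..<T} (\<lambda>s. f' s + \<sigma> / (T - s)\<^sup>2)"
      by (intro continuous_intros f(2)) auto
    show "\<forall>\<^sub>F q in at (t, x) within dom_pos T. U q - (f (fst q) + \<sigma> / (T - fst q)) - g (snd q)
        \<le> U (t, x) - (f t + \<sigma> / (T - t)) - g x"
      using top by eventually_elim (simp add: algebra_simps)
  qed (use g tx in auto)
  moreover have "\<sigma> / T\<^sup>2 \<le> \<sigma> / (T - t)\<^sup>2"
    using tx assms(2) by (intro divide_left_mono power_mono) auto
  ultimately show "f' t + \<sigma> / T\<^sup>2 + H (g' x) \<le> 0 \<or> x = 0 \<and> f' t + \<sigma> / T\<^sup>2 + F (g' x) \<le> 0"
    by auto
qed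

lemma usc_on_penalised:
  assumes "usc_on (dom_init T) U"
  shows "usc_on (dom_init T) (\<lambda>q. U q - \<sigma> / (T - fst q))"
  by (intro usc_on_diff assms continuous_intros) (auto simp: dom_init_def)

section \<open>Growth control\<close>

text \<open>
  Go from \<open>y\<close> to \<open>x\<close> in equal steps shorter than the \<open>d\<close> that uniform continuity provides for
  \<open>\<delta>\<close>; each step costs at most \<open>\<delta>\<close>.
\<close>

lemma uniformly_continuous_modulus:
  fixes w :: "real \<Rightarrow> real"
  assumes "uniformly_continuous_on {0..} w" "0 < \<delta>"
  obtains K where "0 \<le> K" "\<And>x y. 0 \<le> x \<Longrightarrow> 0 \<le> y \<Longrightarrow> \<bar>w x - w y\<bar> \<le> \<delta> + K * \<bar>x - y\<bar>"
proof -
  obtain d where d: "0 < d" "\<And>x y. 0 \<le> x \<Longrightarrow> 0 \<le> y \<Longrightarrow> \<bar>x - y\<bar> < d \<Longrightarrow> \<bar>w x - w y\<bar> < \<delta>"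
    using assms unfolding uniformly_continuous_on_def dist_real_def by (meson atLeast_iff)
  define h where "h = d / 2"
  have h: "0 < h" "h < d" using d by (auto simp: h_def)
  have chain: "\<bar>w x - w y\<bar> \<le> real n * \<delta>" if "0 \<le> x" "0 \<le> y" "\<bar>x - y\<bar> \<le> real n * h" for n x y
    using that
  proof (induction n arbitrary: x)
    case 0
    then show ?case by simp
  next
    case (Suc n)
    define c where "c = real n / real (Suc n)"
    have c: "0 \<le> c" "1 - c = 1 / real (Suc n)" by (auto simp: c_def field_simps)
    define z where "z = y + (x - y) * c"
    have "z = y * (1 - c) + x * c" by (simp add: z_def algebra_simps)
    then have z0: "0 \<le> z" using Suc.prems c by simp
    have "\<bar>z - y\<bar> = \<bar>x - y\<bar> * c" using c(1) by (simp add: z_def abs_mult)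
    also have "\<dots> \<le> real (Suc n) * h * c" using Suc.prems c by (intro mult_right_mono) auto
    also have "\<dots> = real n * h" by (simp add: c_def field_simps)
    finally have 1: "\<bar>w z - w y\<bar> \<le> real n * \<delta>" using Suc.IH[OF z0] Suc.prems by simp
    have "x - z = (x - y) * (1 - c)" by (simp add: z_def algebra_simps)
    then have "\<bar>x - z\<bar> = \<bar>x - y\<bar> / real (Suc n)" by (simp add: c abs_mult)
    also have "\<dots> \<le> h" using Suc.prems by (simp add: field_simps)
    finally have "\<bar>w x - w z\<bar> < \<delta>" using d(2)[OF _ z0, of x] h Suc.prems by simp
    then show ?case using 1 by (simp add: algebra_simps)
  qed
  have "\<bar>w x - w y\<bar> \<le> \<delta> + (\<delta> / h) * \<bar>x - y\<bar>" if "0 \<le> x" "0 \<le> y" for x y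
  proof -
    define n where "n = nat \<lceil>\<bar>x - y\<bar> / h\<rceil>"
    have "\<bar>x - y\<bar> / h \<ge> 0" using h by simp
    then have n: "\<bar>x - y\<bar> / h \<le> real n" "real n \<le> \<bar>x - y\<bar> / h + 1" unfolding n_def by linarith+
    then have "\<bar>x - y\<bar> \<le> real n * h" using h by (simp add: field_simps)
    then have "\<bar>w x - w y\<bar> \<le> real n * \<delta>" using chain that by blast
    also have "\<dots> \<le> (\<bar>x - y\<bar> / h + 1) * \<delta>" using n assms by (intro mult_right_mono) auto
    finally show ?thesis by (simp add: algebra_simps)
  qed
  then show ?thesis using that[of "\<delta> / h"] assms h by simp
qed

lemma DERIV_sqrt_bowl:
  fixes \<theta> :: real
  assumes "\<theta> > 0"
  shows "((\<lambda>x. sqrt (\<theta>\<^sup>2 + (x - y)\<^sup>2)) has_real_derivative (x - y) / sqrt (\<theta>\<^sup>2 + (x - y)\<^sup>2)) (at x)"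
proof -
  have pos: "\<theta>\<^sup>2 + (x - y)\<^sup>2 > 0" using assms by (intro add_pos_nonneg) auto
  have "((\<lambda>x. \<theta>\<^sup>2 + (x - y)\<^sup>2) has_real_derivative 2 * (x - y)) (at x)"
    by (auto intro!: derivative_eq_intros)
  from DERIV_chain2[OF DERIV_real_sqrt[OF pos] this]
  show ?thesis by (rule DERIV_cong) (use pos in \<open>simp add: divide_simps\<close>)
qed

lemma abs_sqrt_bowl_slope_le:
  fixes \<theta> :: real
  assumes "\<theta> > 0"
  shows "\<bar>(x - y) / sqrt (\<theta>\<^sup>2 + (x - y)\<^sup>2)\<bar> \<le> 1"
proof -
  have "\<bar>x - y\<bar> \<le> sqrt (\<theta>\<^sup>2 + (x - y)\<^sup>2)" by (rule real_le_rsqrt) simp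
  moreover have "0 < sqrt (\<theta>\<^sup>2 + (x - y)\<^sup>2)" using assms by (simp add: add_pos_nonneg)
  ultimately show ?thesis by (simp add: abs_divide)
qed

lemma continuous_on_bowl_slope:
  fixes \<theta> :: real
  assumes "\<theta> > 0"
  shows "continuous_on S (\<lambda>x. (x - y) / sqrt (\<theta>\<^sup>2 + (x - y)\<^sup>2))"
proof -
  have "0 < sqrt (\<theta>\<^sup>2 + (x - y)\<^sup>2)" for x using assms by (simp add: add_pos_nonneg)
  then have ne: "sqrt (\<theta>\<^sup>2 + (x - y)\<^sup>2) \<noteq> 0" for x by (metis less_irrefl)
  show ?thesis by (intro continuous_intros ballI ne)
qed

lemma continuous_bounded_on_interval:
  fixes H :: "real \<Rightarrow> real"
  assumes "continuous_on UNIV H"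
  obtains B where "0 \<le> B" "\<And>p. \<bar>p\<bar> \<le> M \<Longrightarrow> \<bar>H p\<bar> \<le> B"
proof -
  have "compact (H ` {-M..M})"
    using assms by (intro compact_continuous_image continuous_on_subset[OF assms]) auto
  then obtain B where "\<forall>p\<in>{-M..M}. \<bar>H p\<bar> \<le> B"
    using compact_imp_bounded bounded_iff[of "H ` {-M..M}"] by auto
  then have "\<bar>H p\<bar> \<le> max B 0" if "\<bar>p\<bar> \<le> M" for p
    using that by (meson abs_le_D1 abs_le_D2 atLeastAtMost_iff max.coboundedI1 minus_le_iff)
  then show ?thesis using that[of "max B 0"] by simp
qed

lemma eventually_at_withinI: "(\<And>q. q \<in> S \<Longrightarrow> P q) \<Longrightarrow> \<forall>\<^sub>F q in at p within S. P q"
  by (simp add: eventually_at_filter)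

text \<open>
  For fixed \<open>y\<close> the function \<open>U\<close> is compared with
  \<open>w y + \<delta> + K sqrt (\<theta>\<^sup>2 + (x - y)\<^sup>2) + L t + \<sigma> / (T - t) + K1 (sqrt (R\<^sup>2 + x\<^sup>2) - R)\<close>.
  Its slope in \<open>x\<close> is at most \<open>K + K1\<close> for every \<open>R\<close>, so a single \<open>L\<close> larger than \<open>\<bar>H\<bar>\<close> and \<open>\<bar>F\<bar>\<close>
  on that range makes it a strict supersolution up to the boundary, whatever the behaviour of
  \<open>H\<close> at infinity. The last term grows faster than \<open>U\<close> can, which confines the contact point, but it
  vanishes pointwise as \<open>R \<rightarrow> \<infinity>\<close>; so \<open>L\<close> survives the limits \<open>R \<rightarrow> \<infinity>\<close> and \<open>\<sigma> \<rightarrow> 0\<close>.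
\<close>

lemma barrier_bound:
  assumes H: "continuous_on UNIV H" and F: "continuous_on UNIV F" and T: "0 < T" and C: "0 \<le> C"
    and usc: "usc_on (dom_init T) U" and visc: "strict_visc_sub T H F 0 U"
    and init: "\<And>x. 0 \<le> x \<Longrightarrow> U (0, x) \<le> w x"
    and growth: "\<And>t x. 0 < t \<Longrightarrow> t < T \<Longrightarrow> 0 \<le> x \<Longrightarrow> U (t, x) \<le> C * (1 + x)"
    and \<delta>: "0 < \<delta>" and K: "0 \<le> K"
    and modulus: "\<And>x y. 0 \<le> x \<Longrightarrow> 0 \<le> y \<Longrightarrow> w x \<le> w y + \<delta> + K * \<bar>x - y\<bar>"
  obtains L where "0 \<le> L"
    "\<And>t x y. 0 \<le> t \<Longrightarrow> t < T \<Longrightarrow> 0 \<le> x \<Longrightarrow> 0 \<le> y \<Longrightarrow> U (t, x) \<le> w y + 2 * \<delta> + K * \<bar>x - y\<bar> + L * t"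
proof -
  define K1 where "K1 = C + 1"
  have K1: "0 \<le> K1" using C by (simp add: K1_def)
  obtain B1 where B1: "\<And>p. \<bar>p\<bar> \<le> K + K1 \<Longrightarrow> \<bar>H p\<bar> \<le> B1" "0 \<le> B1"
    using continuous_bounded_on_interval[OF H, of "K + K1"] by blast
  obtain B2 where B2: "\<And>p. \<bar>p\<bar> \<le> K + K1 \<Longrightarrow> \<bar>F p\<bar> \<le> B2" "0 \<le> B2"
    using continuous_bounded_on_interval[OF F, of "K + K1"] by blast
  define L where "L = B1 + B2 + 1"
  have L: "0 \<le> L" using B1 B2 by (simp add: L_def)
  \<comment> \<open>Smoothing \<open>\<bar>x - y\<bar>\<close> at scale \<open>\<theta>\<close> costs \<open>K \<theta> \<le> \<delta>\<close>, the second \<open>\<delta>\<close> of the claim.\<close>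
  define \<theta> where "\<theta> = \<delta> / (K + 1)"
  have \<theta>: "0 < \<theta>" "K * \<theta> \<le> \<delta>" using \<delta> K by (auto simp: \<theta>_def field_simps)
  have barrier: "U (t, x) \<le> w y + \<delta> + K * sqrt (\<theta>\<^sup>2 + (x - y)\<^sup>2) + L * t + \<sigma> / (T - t) + K1 * (sqrt (R\<^sup>2 + (x - 0)\<^sup>2) - R)"
    if R: "0 < R" and \<sigma>: "0 < \<sigma>" and tx: "0 \<le> t" "t < T" "0 \<le> x" and y: "0 \<le> y" for R \<sigma> t x y
  proof (rule ccontr)
    assume above: "\<not> ?thesis"
    define f where "f = (\<lambda>t. L * t + \<sigma> / (T - t))"
    define f' where "f' = (\<lambda>t. L + \<sigma> / (T - t)\<^sup>2)"
    define g where "g = (\<lambda>x. w y + \<delta> + K * sqrt (\<theta>\<^sup>2 + (x - y)\<^sup>2) + K1 * (sqrt (R\<^sup>2 + (x - 0)\<^sup>2) - R))"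
    define g' where "g' = (\<lambda>x. K * ((x - y) / sqrt (\<theta>\<^sup>2 + (x - y)\<^sup>2)) + K1 * ((x - 0) / sqrt (R\<^sup>2 + (x - 0)\<^sup>2)))"
    define G where "G = (\<lambda>q. U q - f (fst q) - g (snd q))"
    define Q where "Q = C - w y + K1 * R"
    have pos0: "0 < G (t, x)" using above by (simp add: G_def f_def g_def)
    have sq1: "\<bar>x - y\<bar> \<le> sqrt (\<theta>\<^sup>2 + (x - y)\<^sup>2)" for x by (rule real_le_rsqrt) simp
    have sq2: "x \<le> sqrt (R\<^sup>2 + (x - 0)\<^sup>2)" for x by (rule real_le_rsqrt) simp
    have sq3: "R \<le> sqrt (R\<^sup>2 + (x - 0)\<^sup>2)" for x using R by (intro real_le_rsqrt) simp
    have start: "G (0, x) \<le> 0" if "0 \<le> x" for x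
    proof -
      have "U (0, x) \<le> w y + \<delta> + K * \<bar>x - y\<bar>" using init[OF that] modulus[OF that y] by simp
      also have "\<dots> \<le> g x" unfolding g_def
        using mult_left_mono[OF sq1 K, of x] mult_nonneg_nonneg[OF K1, of "sqrt (R\<^sup>2 + (x - 0)\<^sup>2) - R"] sq3[of x] by simp
      finally have "U (0, x) \<le> g x" .
      moreover have "0 < \<sigma> / T" using \<sigma> T by simp
      ultimately show ?thesis by (simp add: G_def f_def)
    qed
    have where_pos: "0 < s \<and> z + \<sigma> / (T - s) < Q" if "0 < G (s, z)" "0 \<le> s" "s < T" "0 \<le> z" for s z
    proof -
      have s: "0 < s" using start[OF that(4)] that by (cases "s = 0") auto
      have "K1 * (z - R) \<le> K1 * (sqrt (R\<^sup>2 + (z - 0)\<^sup>2) - R)" using sq2[of z] K1 by (intro mult_left_mono) auto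
      moreover have "0 \<le> K * sqrt (\<theta>\<^sup>2 + (z - y)\<^sup>2)" using K by simp
      moreover have "0 \<le> L * s" using L s by simp
      moreover have "U (s, z) \<le> C * (1 + z)" using growth s that by blast
      ultimately have "0 < C * (1 + z) - \<sigma> / (T - s) - w y - K1 * (z - R)"
        using that(1) \<delta> unfolding G_def f_def g_def by (simp del: diff_zero)
      then show ?thesis using s by (simp add: Q_def K1_def algebra_simps)
    qed
    have Q: "0 < Q"
    proof -
      have "0 < \<sigma> / (T - t)" using \<sigma> tx by simp
      then show ?thesis using where_pos[OF pos0 tx] tx by linarith
    qed
    let ?K = "{0..T - \<sigma> / Q} \<times> {0..Q}"
    have inK: "(s, z) \<in> ?K" if "0 < G (s, z)" "0 \<le> s" "s < T" "0 \<le> z" for s z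
    proof -
      have *: "z + \<sigma> / (T - s) < Q" using where_pos that by blast
      moreover have "0 < \<sigma> / (T - s)" using \<sigma> that by simp
      ultimately have "z \<le> Q" "\<sigma> / (T - s) < Q" using that by linarith+
      then have "\<sigma> / Q \<le> T - s" using Q that by (simp add: field_simps)
      then show ?thesis using \<open>z \<le> Q\<close> that by auto
    qed
    have "usc_on (dom_init T) (\<lambda>q. U q - (f (fst q) + g (snd q)))"
      unfolding f_def g_def
      by (intro usc_on_diff usc continuous_intros) (auto simp: dom_init_def)
    then have uG: "usc_on (dom_init T) G" by (simp add: G_def algebra_simps)
    have "\<exists>p\<in>?K. \<forall>q\<in>dom_init T. G q \<le> G p"
    proof (rule usc_on_attains_max_outside[OF uG])
      show "compact ?K" by (intro compact_Times) auto
      show "?K \<subseteq> dom_init T" using divide_pos_pos[OF \<sigma> Q] by (auto simp: dom_init_def)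
      show "(t, x) \<in> ?K" by (rule inK[OF pos0 tx])
      fix q assume "q \<in> dom_init T - ?K"
      then have "\<not> 0 < G q" using inK[of "fst q" "snd q"] by (auto simp: dom_init_def)
      then show "G q \<le> G (t, x)" using pos0 by simp
    qed
    then obtain s z where m: "(s, z) \<in> ?K" "\<forall>q\<in>dom_init T. G q \<le> G (s, z)" by force
    have sz: "0 \<le> s" "s < T" "0 \<le> z"
    proof -
      have "0 < \<sigma> / Q" using \<sigma> Q by simp
      then show "0 \<le> s" "s < T" "0 \<le> z" using m(1) by auto
    qed
    have "G (t, x) \<le> G (s, z)" using m(2) tx by (auto simp: dom_init_def)
    then have s: "0 < s" using where_pos[of s z] pos0 sz by simp
    have "f' s + 0 + H (g' z) \<le> 0 \<or> z = 0 \<and> f' s + 0 + F (g' z) \<le> 0"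
    proof (rule strict_visc_subD[OF visc _ _ _ _ s sz(2,3), where f = f and g = g])
      fix s assume s: "0 < s" "s < T"
      have "((\<lambda>s. \<sigma> / (T - s)) has_real_derivative \<sigma> / (T - s)\<^sup>2) (at s)"
        using s by (auto intro!: derivative_eq_intros simp: power2_eq_square)
      then show "(f has_real_derivative f' s) (at s)"
        unfolding f_def f'_def by (intro DERIV_add) (auto intro!: derivative_eq_intros)
    next
      show "continuous_on {0<..<T} f'" unfolding f'_def by (intro continuous_intros) auto
      show "(g has_real_derivative g' z) (at z)" for z
        unfolding g_def g'_def
        by (rule DERIV_cong, (rule DERIV_add DERIV_cmult DERIV_diff DERIV_sqrt_bowl DERIV_const \<theta>(1) R)+) simp
      show "continuous_on {0..} g'" unfolding g'_def
        by (intro continuous_on_add continuous_on_mult_left continuous_on_bowl_slope \<theta>(1) R)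
      show "\<forall>\<^sub>F q in at (s, z) within dom_pos T. U q - f (fst q) - g (snd q) \<le> U (s, z) - f s - g z"
        using m(2) by (intro eventually_at_withinI) (auto simp: G_def dom_pos_def dom_init_def)
    qed
    moreover have "\<bar>g' z\<bar> \<le> K + K1"
    proof -
      have "\<bar>K * ((z - y) / sqrt (\<theta>\<^sup>2 + (z - y)\<^sup>2))\<bar> \<le> K * 1"
        unfolding abs_mult using K abs_sqrt_bowl_slope_le[OF \<theta>(1)] by (simp only: abs_of_nonneg mult_left_mono)
      moreover have "\<bar>K1 * ((z - 0) / sqrt (R\<^sup>2 + (z - 0)\<^sup>2))\<bar> \<le> K1 * 1"
        unfolding abs_mult using K1 abs_sqrt_bowl_slope_le[OF R] by (simp only: abs_of_nonneg mult_left_mono)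
      ultimately show ?thesis unfolding g'_def by linarith
    qed
    then have "\<bar>H (g' z)\<bar> \<le> B1" "\<bar>F (g' z)\<bar> \<le> B2" using B1 B2 by blast+
    moreover have "L \<le> f' s" using \<sigma> by (simp add: f'_def)
    ultimately show False using B1(2) B2(2) unfolding L_def by linarith
  qed
  have "U (t, x) \<le> w y + 2 * \<delta> + K * \<bar>x - y\<bar> + L * t"
    if tx: "0 \<le> t" "t < T" "0 \<le> x" and y: "0 \<le> y" for t x y
  proof (rule field_le_epsilon)
    fix e :: real assume e: "0 < e"
    \<comment> \<open>Each of the two auxiliary terms of the barrier is made at most \<open>e / 2\<close> at \<open>(t, x)\<close>.\<close>
    define \<sigma> where "\<sigma> = e / 2 * (T - t)"
    define R where "R = (K1 * x\<^sup>2 + 1) / e"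
    have "0 < T - t" using tx by simp
    then have \<sigma>: "0 < \<sigma>" "\<sigma> / (T - t) = e / 2" using e unfolding \<sigma>_def
      by (simp, intro nonzero_mult_div_cancel_right) simp
    have R: "0 < R" using e K1 by (auto simp: R_def intro!: divide_pos_pos add_nonneg_pos)
    have "sqrt (R\<^sup>2 + (x - 0)\<^sup>2) \<le> R + x\<^sup>2 / (2 * R)"
    proof (rule real_le_lsqrt)
      show "R\<^sup>2 + (x - 0)\<^sup>2 \<le> (R + x\<^sup>2 / (2 * R))\<^sup>2" using R by (simp add: power2_sum)
    qed (use R in auto)
    then have "K1 * (sqrt (R\<^sup>2 + (x - 0)\<^sup>2) - R) \<le> K1 * (x\<^sup>2 / (2 * R))"
      using K1 by (intro mult_left_mono) auto
    also have "\<dots> = (K1 * x\<^sup>2) / (2 * R)" by simp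
    also have "\<dots> \<le> (e * R) / (2 * R)"
    proof (rule divide_right_mono)
      show "K1 * x\<^sup>2 \<le> e * R" using e by (simp add: R_def)
    qed (use R in simp)
    also have "\<dots> = e / 2" using R by simp
    finally have 1: "K1 * (sqrt (R\<^sup>2 + (x - 0)\<^sup>2) - R) \<le> e / 2" .
    have "sqrt (\<theta>\<^sup>2 + (x - y)\<^sup>2) \<le> \<theta> + \<bar>x - y\<bar>"
      using \<theta> sqrt_add_le_add_sqrt[of "\<theta>\<^sup>2" "(x - y)\<^sup>2"] by simp
    then have "K * sqrt (\<theta>\<^sup>2 + (x - y)\<^sup>2) \<le> K * (\<theta> + \<bar>x - y\<bar>)" using K by (rule mult_left_mono)
    then have "K * sqrt (\<theta>\<^sup>2 + (x - y)\<^sup>2) \<le> \<delta> + K * \<bar>x - y\<bar>" using \<theta>(2) by (simp add: distrib_left)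
    then show "U (t, x) \<le> w y + 2 * \<delta> + K * \<bar>x - y\<bar> + L * t + e"
      using barrier[OF R \<sigma>(1) tx y] 1 \<sigma>(2) by linarith
  qed
  then show ?thesis using that L by blast
qed

section \<open>Doubling the variables\<close>

lemma linear_minus_square_le:
  fixes L s \<nu> :: real
  assumes "0 < \<nu>"
  shows "L * s - s\<^sup>2 / (2 * \<nu>) \<le> L\<^sup>2 * \<nu> / 2"
proof -
  have "0 \<le> (s - L * \<nu>)\<^sup>2 / (2 * \<nu>)" using assms by simp
  also have "\<dots> = s\<^sup>2 / (2 * \<nu>) - L * s + L\<^sup>2 * \<nu> / 2"
    using assms by (simp add: field_simps power2_eq_square)
  finally show ?thesis by simp
qed

lemma abs_le_one_plus_square: "\<bar>z\<bar> \<le> 1 + z\<^sup>2" for z :: real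
proof -
  have "0 \<le> (\<bar>z\<bar> - 1)\<^sup>2 + \<bar>z\<bar>" by simp
  then show ?thesis by (simp add: power2_diff)
qed

lemma DERIV_half_square:
  fixes a c :: real
  assumes "0 < c"
  shows "((\<lambda>x. (x - a)\<^sup>2 / (2 * c)) has_real_derivative (x - a) / c) (at x)"
proof -
  have "((\<lambda>x. (x - a)\<^sup>2) has_real_derivative 2 * (x - a)) (at x)"
    by (auto intro!: derivative_eq_intros)
  from DERIV_cdivide[OF this, of "2 * c"] show ?thesis
    by (rule DERIV_cong) (use assms in \<open>simp add: field_simps\<close>)
qed

text \<open>
  The two strict subsolutions to be compared. By \<open>bound\<close> and \<open>base\<close>, the starting value at
  \<open>(t1, x1)\<close> exceeds what the doubled functional can reach when one of the times is \<open>0\<close>; the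
  reserve \<open>L\<^sup>2 \<nu>\<close> is the gain from \<open>L (t + s) + L \<bar>x - y\<bar>\<close> that the quadratic penalties allow when
  \<open>\<epsilon> \<le> \<nu>\<close>.
\<close>

locale doubled_pair =
  fixes T m \<delta> L \<sigma> \<nu> t1 x1 :: real and H F :: "real \<Rightarrow> real" and A B :: "real \<times> real \<Rightarrow> real"
  assumes pos: "0 < T" "0 < m" "0 < \<sigma>" "0 \<le> L" "0 \<le> \<delta>" "0 < \<nu>"
    and H: "continuous_on UNIV H"
    and uscA: "usc_on (dom_init T) A" and uscB: "usc_on (dom_init T) B"
    and viscA: "strict_visc_sub T H F m A"
    and viscB: "strict_visc_sub T (\<lambda>p. - H (- p)) (\<lambda>p. - F (- p)) m B"
    and bound: "\<And>t s x y. 0 \<le> t \<Longrightarrow> t < T \<Longrightarrow> 0 \<le> s \<Longrightarrow> s < T \<Longrightarrow> 0 \<le> x \<Longrightarrow> 0 \<le> y \<Longrightarrow>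
      A (t, x) + B (s, y) \<le> \<delta> + L * (t + s) + L * \<bar>x - y\<bar> - \<sigma> / (T - t) - \<sigma> / (T - s)"
    and base: "0 \<le> t1" "t1 < T" "0 \<le> x1" "\<delta> + L\<^sup>2 * \<nu> < A (t1, x1) + B (t1, x1)"
begin

definition Q :: real where "Q = \<delta> + 2 * L * T + L\<^sup>2 * \<nu>"

text \<open>
  A point is \<open>((t, x), (s, y))\<close>. The penalty \<open>\<alpha> x\<close> needs to restrain \<open>x\<close> only: \<open>y\<close> stays near
  \<open>x\<close>.
\<close>

definition \<Psi> :: "real \<Rightarrow> real \<Rightarrow> (real \<times> real) \<times> (real \<times> real) \<Rightarrow> real" where
  "\<Psi> \<epsilon> \<alpha> q = A (fst q) + B (snd q) - (fst (fst q) - fst (snd q))\<^sup>2 / (2 * \<nu>)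
     - (snd (fst q) - snd (snd q))\<^sup>2 / (2 * \<epsilon>) - \<alpha> * snd (fst q)"

text \<open>
  The linear growth \<open>L \<bar>x - y\<bar>\<close> is absorbed by half of the penalty \<open>(x - y)\<^sup>2 / (2 \<epsilon>)\<close>; the other half
  and the remaining penalties are then bounded by \<open>Q\<close>, uniformly in \<open>\<epsilon>\<close> and \<open>\<alpha>\<close>.
\<close>

lemma location:
  assumes \<epsilon>: "0 < \<epsilon>" "\<epsilon> \<le> \<nu>" and "0 \<le> t" "t < T" "0 \<le> s" "s < T" "0 \<le> x" "0 \<le> y"
    and "0 < \<Psi> \<epsilon> \<alpha> ((t, x), (s, y))"
  shows "(x - y)\<^sup>2 / (4 * \<epsilon>) + \<sigma> / (T - t) + \<sigma> / (T - s) + \<alpha> * x < Q"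
proof -
  have "L * \<bar>x - y\<bar> - \<bar>x - y\<bar>\<^sup>2 / (2 * (2 * \<epsilon>)) \<le> L\<^sup>2 * (2 * \<epsilon>) / 2"
    using \<epsilon> by (intro linear_minus_square_le) simp
  then have "L * \<bar>x - y\<bar> - (x - y)\<^sup>2 / (4 * \<epsilon>) \<le> L\<^sup>2 * \<epsilon>" by simp
  also have "\<dots> \<le> L\<^sup>2 * \<nu>" using \<epsilon> by (intro mult_left_mono) auto
  finally have 1: "L * \<bar>x - y\<bar> - (x - y)\<^sup>2 / (4 * \<epsilon>) \<le> L\<^sup>2 * \<nu>" .
  have 2: "(x - y)\<^sup>2 / (2 * \<epsilon>) = (x - y)\<^sup>2 / (4 * \<epsilon>) + (x - y)\<^sup>2 / (4 * \<epsilon>)" by simp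
  have "L * (t + s) \<le> L * (T + T)" using assms pos by (intro mult_left_mono) auto
  then have 3: "L * (t + s) \<le> 2 * L * T" by simp
  have 4: "0 \<le> (t - s)\<^sup>2 / (2 * \<nu>)" using pos by simp
  have 5: "0 < A (t, x) + B (s, y) - (t - s)\<^sup>2 / (2 * \<nu>) - (x - y)\<^sup>2 / (2 * \<epsilon>) - \<alpha> * x"
    using assms(9) by (simp add: \<Psi>_def)
  show ?thesis using bound[OF assms(3-8)] 1 2 3 4 5 unfolding Q_def by linarith
qed

lemma positive_times:
  assumes \<epsilon>: "0 < \<epsilon>" "\<epsilon> \<le> \<nu>" and dom: "0 \<le> t" "t < T" "0 \<le> s" "s < T" "0 \<le> x" "0 \<le> y"
    and \<alpha>: "0 \<le> \<alpha>" and big: "\<delta> + L\<^sup>2 * \<nu> < \<Psi> \<epsilon> \<alpha> ((t, x), (s, y))"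
  shows "0 < t \<and> 0 < s"
proof (rule ccontr)
  assume "\<not> ?thesis"
  then have z: "t = 0 \<or> s = 0" using dom by auto
  have 1: "L * (t + s) - (t - s)\<^sup>2 / (2 * \<nu>) \<le> L\<^sup>2 * \<nu> / 2"
    using z linear_minus_square_le[OF pos(6), of L "t + s"] by auto
  have "L * \<bar>x - y\<bar> - \<bar>x - y\<bar>\<^sup>2 / (2 * \<epsilon>) \<le> L\<^sup>2 * \<epsilon> / 2"
    using \<epsilon> by (intro linear_minus_square_le) simp
  moreover have "L\<^sup>2 * \<epsilon> \<le> L\<^sup>2 * \<nu>" using \<epsilon> by (intro mult_left_mono) auto
  ultimately have 2: "L * \<bar>x - y\<bar> - (x - y)\<^sup>2 / (2 * \<epsilon>) \<le> L\<^sup>2 * \<nu> / 2" by simp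
  have 3: "0 < \<sigma> / (T - t)" "0 < \<sigma> / (T - s)" "0 \<le> \<alpha> * x" using dom pos \<alpha> by auto
  have "\<delta> + L\<^sup>2 * \<nu> < A (t, x) + B (s, y) - (t - s)\<^sup>2 / (2 * \<nu>) - (x - y)\<^sup>2 / (2 * \<epsilon>) - \<alpha> * x"
    using big by (simp add: \<Psi>_def)
  then show False using bound[OF dom] 1 2 3 by linarith
qed

lemma usc_\<Psi>:
  assumes "0 < \<epsilon>"
  shows "usc_on (dom_init T \<times> dom_init T) (\<Psi> \<epsilon> \<alpha>)"
proof -
  have "usc_on (dom_init T \<times> dom_init T) (\<lambda>q. A (fst q) + B (snd q))"
    by (intro usc_on_add usc_on_compose[OF uscA] usc_on_compose[OF uscB] continuous_intros) auto
  then have "usc_on (dom_init T \<times> dom_init T) (\<lambda>q. A (fst q) + B (snd q)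
      - ((fst (fst q) - fst (snd q))\<^sup>2 / (2 * \<nu>) + (snd (fst q) - snd (snd q))\<^sup>2 / (2 * \<epsilon>) + \<alpha> * snd (fst q)))"
    using assms pos by (intro usc_on_diff continuous_intros) auto
  then show ?thesis by (simp add: \<Psi>_def[abs_def] algebra_simps)
qed

lemma Q_pos: "0 \<le> Q" using pos by (simp add: Q_def)

lemma maximum_exists:
  assumes \<epsilon>: "0 < \<epsilon>" "\<epsilon> \<le> \<nu>" and \<alpha>: "0 < \<alpha>"
    and start: "0 < \<Psi> \<epsilon> \<alpha> ((t1, x1), (t1, x1))"
  obtains t x s y where "0 \<le> t" "t < T" "0 \<le> s" "s < T" "0 \<le> x" "0 \<le> y"
    "\<And>q. q \<in> dom_init T \<times> dom_init T \<Longrightarrow> \<Psi> \<epsilon> \<alpha> q \<le> \<Psi> \<epsilon> \<alpha> ((t, x), (s, y))"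
proof -
  define Y where "Y = Q / \<alpha> + (1 + 4 * \<epsilon> * Q)"
  let ?D = "dom_init T \<times> dom_init T"
  let ?J = "{0..T - \<sigma> / Q} \<times> {0..Y}"
  have inK: "q \<in> ?J \<times> ?J \<and> 0 < Q" if D: "q \<in> ?D" and p: "0 < \<Psi> \<epsilon> \<alpha> q" for q
  proof -
    obtain t x s y where q: "q = ((t, x), (s, y))" by (metis surj_pair)
    have d: "0 \<le> t" "t < T" "0 \<le> s" "s < T" "0 \<le> x" "0 \<le> y" using D q by (auto simp: dom_init_def)
    have le: "(x - y)\<^sup>2 / (4 * \<epsilon>) + \<sigma> / (T - t) + \<sigma> / (T - s) + \<alpha> * x < Q"
      by (rule location[OF \<epsilon> d]) (use p q in simp)
    have nn: "0 \<le> (x - y)\<^sup>2 / (4 * \<epsilon>)" "0 < \<sigma> / (T - t)" "0 < \<sigma> / (T - s)" "0 \<le> \<alpha> * x"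
      using d pos \<epsilon> \<alpha> by auto
    have Q: "0 < Q" using le nn by linarith
    have "\<sigma> / (T - t) < Q" "\<sigma> / (T - s) < Q" "\<alpha> * x < Q" "(x - y)\<^sup>2 / (4 * \<epsilon>) < Q" using le nn by linarith+
    then have b: "\<sigma> / Q \<le> T - t" "\<sigma> / Q \<le> T - s" "x \<le> Q / \<alpha>" "(x - y)\<^sup>2 \<le> 4 * \<epsilon> * Q"
      using Q d \<alpha> \<epsilon> by (simp_all add: field_simps)
    have "\<bar>x - y\<bar> \<le> 1 + (x - y)\<^sup>2" by (rule abs_le_one_plus_square)
    then have "x \<le> Y" "y \<le> Y" using b Q \<epsilon> unfolding Y_def by (auto intro!: add_increasing2)
    then show ?thesis using q b d Q by auto
  qed
  let ?p0 = "((t1, x1), (t1, x1))"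
  have p0: "?p0 \<in> ?D" using base by (simp add: dom_init_def)
  then have Q: "0 < Q" using inK start by blast
  have "\<exists>p\<in>?J \<times> ?J. \<forall>q\<in>?D. \<Psi> \<epsilon> \<alpha> q \<le> \<Psi> \<epsilon> \<alpha> p"
  proof (rule usc_on_attains_max_outside[OF usc_\<Psi>[OF \<epsilon>(1)]])
    show "compact (?J \<times> ?J)" by (intro compact_Times) auto
    show sub: "?J \<times> ?J \<subseteq> ?D" using divide_pos_pos[OF pos(3) Q] by (auto simp: dom_init_def)
    show "?p0 \<in> ?J \<times> ?J" using inK[OF p0 start] by blast
    fix q assume "q \<in> ?D - ?J \<times> ?J"
    then have "\<not> 0 < \<Psi> \<epsilon> \<alpha> q" using inK by blast
    then show "\<Psi> \<epsilon> \<alpha> q \<le> \<Psi> \<epsilon> \<alpha> ?p0" using start by linarith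
  qed
  then obtain p where p: "p \<in> ?J \<times> ?J" "\<And>q. q \<in> ?D \<Longrightarrow> \<Psi> \<epsilon> \<alpha> q \<le> \<Psi> \<epsilon> \<alpha> p" by blast
  obtain t x s y where q: "p = ((t, x), (s, y))" by (metis surj_pair)
  show ?thesis
    by (rule that[of t s x y]) (use p q divide_pos_pos[OF pos(3) Q] in auto)
qed

lemma slope_continuity:
  obtains \<alpha>0 where "0 < \<alpha>0" "\<And>p \<alpha>. \<bar>p\<bar> \<le> P \<Longrightarrow> 0 < \<alpha> \<Longrightarrow> \<alpha> < \<alpha>0 \<Longrightarrow> H p < H (p + \<alpha>) + m"
proof -
  have "uniformly_continuous_on {- P - 1..P + 1} H"
    by (intro compact_uniformly_continuous continuous_on_subset[OF H]) auto
  then obtain d where d: "0 < d" "\<And>p q. p \<in> {- P - 1..P + 1} \<Longrightarrow> q \<in> {- P - 1..P + 1} \<Longrightarrow>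
      dist q p < d \<Longrightarrow> dist (H q) (H p) < m"
    using pos(2) unfolding uniformly_continuous_on_def by meson
  show ?thesis
  proof (rule that[of "min d 1"])
    fix p \<alpha> :: real assume a: "\<bar>p\<bar> \<le> P" "0 < \<alpha>" "\<alpha> < min d 1"
    then have "dist (H (p + \<alpha>)) (H p) < m" by (intro d(2)) (auto simp: dist_real_def)
    then show "H p < H (p + \<alpha>) + m" by (simp add: dist_real_def)
  qed (use d in auto)
qed

text \<open>
  Adding the two viscosity inequalities cancels the time derivatives \<open>\<plusminus> (t - s) / \<nu>\<close>. The slopes seen by
  \<open>A\<close> and \<open>B\<close> differ only by the \<open>\<alpha>\<close> of the localisation.
\<close>

lemma interior_inequality:
  assumes \<epsilon>: "0 < \<epsilon>" and d: "0 < t" "t < T" "0 < s" "s < T" "0 < x" "0 < y"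
    and top: "\<And>q. q \<in> dom_init T \<times> dom_init T \<Longrightarrow> \<Psi> \<epsilon> \<alpha> q \<le> \<Psi> \<epsilon> \<alpha> ((t, x), (s, y))"
  shows "2 * m + H ((x - y) / \<epsilon> + \<alpha>) \<le> H ((x - y) / \<epsilon>)"
proof -
  have sub: "dom_pos T \<subseteq> dom_init T" by (auto simp: dom_pos_def dom_init_def)
  have in1: "(t, x) \<in> dom_init T" "(s, y) \<in> dom_init T" using d by (auto simp: dom_init_def)
  have "(t - s) / \<nu> + m + H ((x - y) / \<epsilon> + \<alpha>) \<le> 0 \<or> x = 0 \<and> (t - s) / \<nu> + m + F ((x - y) / \<epsilon> + \<alpha>) \<le> 0"
  proof (rule strict_visc_subD[OF viscA, where f = "\<lambda>t. (t - s)\<^sup>2 / (2 * \<nu>)" and f' = "\<lambda>t. (t - s) / \<nu>"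
        and g = "\<lambda>x. (x - y)\<^sup>2 / (2 * \<epsilon>) + \<alpha> * x" and g' = "\<lambda>x. (x - y) / \<epsilon> + \<alpha>"])
    show "((\<lambda>t. (t - s)\<^sup>2 / (2 * \<nu>)) has_real_derivative (t - s) / \<nu>) (at t)" for t
      by (rule DERIV_half_square[OF pos(6)])
    show "((\<lambda>x. (x - y)\<^sup>2 / (2 * \<epsilon>) + \<alpha> * x) has_real_derivative (x - y) / \<epsilon> + \<alpha>) (at x)" for x
      using DERIV_add[OF DERIV_half_square[OF \<epsilon>] DERIV_cmult_Id] .
    show "continuous_on {0<..<T} (\<lambda>t. (t - s) / \<nu>)"
      by (intro continuous_intros) (use pos in auto)
    show "continuous_on {0..} (\<lambda>x. (x - y) / \<epsilon> + \<alpha>)"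
      by (intro continuous_intros) (use \<epsilon> in auto)
    show "\<forall>\<^sub>F q in at (t, x) within dom_pos T. A q - (fst q - s)\<^sup>2 / (2 * \<nu>) - ((snd q - y)\<^sup>2 / (2 * \<epsilon>) + \<alpha> * snd q)
        \<le> A (t, x) - (t - s)\<^sup>2 / (2 * \<nu>) - ((x - y)\<^sup>2 / (2 * \<epsilon>) + \<alpha> * x)"
    proof (rule eventually_at_withinI)
      fix q assume "q \<in> dom_pos T"
      then have "\<Psi> \<epsilon> \<alpha> (q, (s, y)) \<le> \<Psi> \<epsilon> \<alpha> ((t, x), (s, y))" using sub in1 by (intro top) auto
      then show "A q - (fst q - s)\<^sup>2 / (2 * \<nu>) - ((snd q - y)\<^sup>2 / (2 * \<epsilon>) + \<alpha> * snd q)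
        \<le> A (t, x) - (t - s)\<^sup>2 / (2 * \<nu>) - ((x - y)\<^sup>2 / (2 * \<epsilon>) + \<alpha> * x)"
        by (simp add: \<Psi>_def)
    qed
  qed (use d in auto)
  moreover have "(s - t) / \<nu> + m + - H (- ((y - x) / \<epsilon>)) \<le> 0 \<or> y = 0 \<and> (s - t) / \<nu> + m + - F (- ((y - x) / \<epsilon>)) \<le> 0"
  proof (rule strict_visc_subD[OF viscB, where f = "\<lambda>s. (s - t)\<^sup>2 / (2 * \<nu>)" and f' = "\<lambda>s. (s - t) / \<nu>"
        and g = "\<lambda>y. (y - x)\<^sup>2 / (2 * \<epsilon>)" and g' = "\<lambda>y. (y - x) / \<epsilon>"])
    show "((\<lambda>s. (s - t)\<^sup>2 / (2 * \<nu>)) has_real_derivative (s - t) / \<nu>) (at s)" for s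
      by (rule DERIV_half_square[OF pos(6)])
    show "((\<lambda>y. (y - x)\<^sup>2 / (2 * \<epsilon>)) has_real_derivative (y - x) / \<epsilon>) (at y)" for y
      by (rule DERIV_half_square[OF \<epsilon>])
    show "continuous_on {0<..<T} (\<lambda>s. (s - t) / \<nu>)"
      by (intro continuous_intros) (use pos in auto)
    show "continuous_on {0..} (\<lambda>y. (y - x) / \<epsilon>)"
      by (intro continuous_intros) (use \<epsilon> in auto)
    show "\<forall>\<^sub>F q in at (s, y) within dom_pos T. B q - (fst q - t)\<^sup>2 / (2 * \<nu>) - (snd q - x)\<^sup>2 / (2 * \<epsilon>)
        \<le> B (s, y) - (s - t)\<^sup>2 / (2 * \<nu>) - (y - x)\<^sup>2 / (2 * \<epsilon>)"
    proof (rule eventually_at_withinI)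
      fix q assume "q \<in> dom_pos T"
      then have "\<Psi> \<epsilon> \<alpha> ((t, x), q) \<le> \<Psi> \<epsilon> \<alpha> ((t, x), (s, y))" using sub in1 by (intro top) auto
      then show "B q - (fst q - t)\<^sup>2 / (2 * \<nu>) - (snd q - x)\<^sup>2 / (2 * \<epsilon>)
        \<le> B (s, y) - (s - t)\<^sup>2 / (2 * \<nu>) - (y - x)\<^sup>2 / (2 * \<epsilon>)"
        by (simp add: \<Psi>_def power2_commute)
    qed
  qed (use d in auto)
  moreover have "- ((y - x) / \<epsilon>) = (x - y) / \<epsilon>" "(s - t) / \<nu> = - ((t - s) / \<nu>)"
    by (simp_all add: minus_divide_left)
  ultimately show ?thesis using d by simp
qed

text \<open>
  For fixed \<open>\<epsilon>\<close> the slope \<open>(x - y) / \<epsilon>\<close> is bounded independently of \<open>\<alpha>\<close>, so once \<open>\<alpha>\<close> is small the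
  inequality of \<open>interior_inequality\<close> contradicts the uniform continuity of \<open>H\<close> on a bounded
  interval. The bound deteriorates as \<open>\<epsilon> \<rightarrow> 0\<close>, hence \<open>\<alpha>\<close> is chosen after \<open>\<epsilon>\<close>.
\<close>

lemma boundary_point_of_maximum:
  assumes \<epsilon>: "0 < \<epsilon>" "\<epsilon> \<le> \<nu>" and "0 < \<mu>"
  obtains \<alpha> t x s y where "0 < \<alpha>" "\<alpha> < \<mu>" "0 \<le> t" "0 \<le> s" "0 \<le> x" "0 \<le> y" "x = 0 \<or> y = 0"
    "(x - y)\<^sup>2 \<le> 4 * \<epsilon> * Q" "\<sigma> \<le> Q * (T - t)" "\<sigma> \<le> Q * (T - s)"
    "\<And>q. q \<in> dom_init T \<times> dom_init T \<Longrightarrow> \<Psi> \<epsilon> \<alpha> q \<le> \<Psi> \<epsilon> \<alpha> ((t, x), (s, y))"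
proof -
  \<comment> \<open>From \<open>(x - y)\<^sup>2 \<le> 4 \<epsilon> Q\<close> the slope \<open>p\<close> satisfies \<open>p\<^sup>2 \<le> 4 Q / \<epsilon>\<close>, and \<open>\<bar>p\<bar> \<le> 1 + p\<^sup>2\<close>.\<close>
  define P where "P = 1 + 4 * Q / \<epsilon>"
  obtain \<alpha>0 where \<alpha>0: "0 < \<alpha>0" "\<And>p \<alpha>. \<bar>p\<bar> \<le> P \<Longrightarrow> 0 < \<alpha> \<Longrightarrow> \<alpha> < \<alpha>0 \<Longrightarrow> H p < H (p + \<alpha>) + m"
    using slope_continuity[of P] by blast
  define gap where "gap = A (t1, x1) + B (t1, x1) - (\<delta> + L\<^sup>2 * \<nu>)"
  have gap: "0 < gap" using base by (simp add: gap_def)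
  define h where "h = gap / (x1 + 1)"
  have "0 < h" using gap base by (simp add: h_def)
  then obtain \<alpha> where \<alpha>: "0 < \<alpha>" "\<alpha> < \<mu>" "\<alpha> < \<alpha>0" "\<alpha> < h"
    using dense[of 0 "min (min \<mu> \<alpha>0) h"] assms(3) \<alpha>0(1) by auto
  have "\<alpha> * x1 \<le> \<alpha> * (x1 + 1)" using \<alpha> by (intro mult_left_mono) auto
  also have "\<dots> < gap" using \<alpha>(4) base(3) by (simp add: h_def field_simps)
  finally have start: "\<delta> + L\<^sup>2 * \<nu> < \<Psi> \<epsilon> \<alpha> ((t1, x1), (t1, x1))" by (simp add: \<Psi>_def gap_def)
  moreover have "0 \<le> \<delta> + L\<^sup>2 * \<nu>" using pos by simp
  ultimately have start0: "0 < \<Psi> \<epsilon> \<alpha> ((t1, x1), (t1, x1))" by linarith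
  obtain t x s y where d: "0 \<le> t" "t < T" "0 \<le> s" "s < T" "0 \<le> x" "0 \<le> y"
    and top: "\<And>q. q \<in> dom_init T \<times> dom_init T \<Longrightarrow> \<Psi> \<epsilon> \<alpha> q \<le> \<Psi> \<epsilon> \<alpha> ((t, x), (s, y))"
    by (rule maximum_exists[OF \<epsilon> \<alpha>(1) start0]) (rule that, assumption+)
  have val: "\<delta> + L\<^sup>2 * \<nu> < \<Psi> \<epsilon> \<alpha> ((t, x), (s, y))" "0 < \<Psi> \<epsilon> \<alpha> ((t, x), (s, y))"
    using top[of "((t1, x1), (t1, x1))"] start start0 base by (auto simp: dom_init_def)
  have ts: "0 < t" "0 < s" using positive_times[OF \<epsilon> d less_imp_le[OF \<alpha>(1)] val(1)] by auto
  have le: "(x - y)\<^sup>2 / (4 * \<epsilon>) + \<sigma> / (T - t) + \<sigma> / (T - s) + \<alpha> * x < Q"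
    by (rule location[OF \<epsilon> d val(2)])
  moreover have "0 \<le> (x - y)\<^sup>2 / (4 * \<epsilon>)" "0 < \<sigma> / (T - t)" "0 < \<sigma> / (T - s)" "0 \<le> \<alpha> * x"
    using d pos \<epsilon> \<alpha> by auto
  ultimately have "(x - y)\<^sup>2 / (4 * \<epsilon>) < Q" "\<sigma> / (T - t) < Q" "\<sigma> / (T - s) < Q" by linarith+
  then have b: "(x - y)\<^sup>2 \<le> 4 * \<epsilon> * Q" "\<sigma> \<le> Q * (T - t)" "\<sigma> \<le> Q * (T - s)"
    using d \<epsilon> by (simp_all add: field_simps)
  have "x = 0 \<or> y = 0"
  proof (rule ccontr)
    assume "\<not> ?thesis"
    then have xy: "0 < x" "0 < y" using d by auto
    let ?p = "(x - y) / \<epsilon>"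
    have "?p\<^sup>2 = (x - y)\<^sup>2 / \<epsilon>\<^sup>2" by (simp add: power_divide)
    also have "\<dots> \<le> 4 * \<epsilon> * Q / \<epsilon>\<^sup>2" using b by (intro divide_right_mono) auto
    also have "\<dots> = 4 * Q / \<epsilon>" using \<epsilon> by (simp add: power2_eq_square)
    finally have "?p\<^sup>2 \<le> 4 * Q / \<epsilon>" .
    moreover have "\<bar>?p\<bar> \<le> 1 + ?p\<^sup>2" by (rule abs_le_one_plus_square)
    ultimately have "\<bar>?p\<bar> \<le> P" unfolding P_def by linarith
    then have "H ?p < H (?p + \<alpha>) + m" using \<alpha>0(2) \<alpha> by blast
    moreover have "2 * m + H (?p + \<alpha>) \<le> H ?p"
      by (rule interior_inequality[OF \<epsilon>(1) ts(1) d(2) ts(2) d(4) xy top])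
    ultimately show False using pos(2) by linarith
  qed
  then show ?thesis by (intro that[OF \<alpha>(1,2) d(1,3,5,6) _ b top])
qed

text \<open>
  With \<open>\<epsilon> \<rightarrow> 0\<close> and \<open>\<alpha> \<rightarrow> 0\<close> together, the maximum points have \<open>\<bar>x - y\<bar> \<rightarrow> 0\<close> and one of \<open>x\<close>, \<open>y\<close> zero,
  so they stay in a compact set and accumulate at a point with \<open>x = y = 0\<close>. On the diagonal
  \<open>x = y\<close> the space penalty vanishes, and upper semicontinuity passes the maximality to the limit.
\<close>

lemma boundary_maximum:
  obtains t0 s0 where "0 < t0" "t0 < T" "0 < s0" "s0 < T"
    "\<And>t s x. 0 \<le> t \<Longrightarrow> t < T \<Longrightarrow> 0 \<le> s \<Longrightarrow> s < T \<Longrightarrow> 0 \<le> x \<Longrightarrow>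
      A (t, x) + B (s, x) - (t - s)\<^sup>2 / (2 * \<nu>) \<le> A (t0, 0) + B (s0, 0) - (t0 - s0)\<^sup>2 / (2 * \<nu>)"
proof -
  let ?D = "dom_init T \<times> dom_init T"
  have "\<forall>n. \<exists>\<alpha> t x s y. 0 < \<alpha> \<and> \<alpha> < inverse (real (Suc n)) \<and> 0 \<le> t \<and> 0 \<le> s \<and> 0 \<le> x \<and> 0 \<le> y \<and> (x = 0 \<or> y = 0) \<and>
    (x - y)\<^sup>2 \<le> 4 * (\<nu> * inverse (real (Suc n))) * Q \<and> \<sigma> \<le> Q * (T - t) \<and> \<sigma> \<le> Q * (T - s) \<and>
    (\<forall>q\<in>?D. \<Psi> (\<nu> * inverse (real (Suc n))) \<alpha> q \<le> \<Psi> (\<nu> * inverse (real (Suc n))) \<alpha> ((t, x), (s, y)))"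
  proof
    fix n
    have "inverse (real (Suc n)) \<le> 1" by (intro inverse_le_1_iff[THEN iffD2]) simp
    then have "\<nu> * inverse (real (Suc n)) \<le> \<nu> * 1" using pos by (intro mult_left_mono) auto
    then have 1: "\<nu> * inverse (real (Suc n)) \<le> \<nu>" by simp
    have 2: "0 < \<nu> * inverse (real (Suc n))" using pos by simp
    have 3: "0 < inverse (real (Suc n))" by simp
    show "\<exists>\<alpha> t x s y. 0 < \<alpha> \<and> \<alpha> < inverse (real (Suc n)) \<and> 0 \<le> t \<and> 0 \<le> s \<and> 0 \<le> x \<and> 0 \<le> y \<and> (x = 0 \<or> y = 0) \<and>
      (x - y)\<^sup>2 \<le> 4 * (\<nu> * inverse (real (Suc n))) * Q \<and> \<sigma> \<le> Q * (T - t) \<and> \<sigma> \<le> Q * (T - s) \<and>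
      (\<forall>q\<in>?D. \<Psi> (\<nu> * inverse (real (Suc n))) \<alpha> q \<le> \<Psi> (\<nu> * inverse (real (Suc n))) \<alpha> ((t, x), (s, y)))"
      by (rule boundary_point_of_maximum[OF 2 1 3]) blast
  qed
  then obtain \<alpha> t x s y where sel: "\<And>n. 0 < \<alpha> n \<and> \<alpha> n < inverse (real (Suc n)) \<and> 0 \<le> t n \<and> 0 \<le> s n \<and> 0 \<le> x n \<and> 0 \<le> y n \<and> (x n = 0 \<or> y n = 0) \<and>
    (x n - y n)\<^sup>2 \<le> 4 * (\<nu> * inverse (real (Suc n))) * Q \<and> \<sigma> \<le> Q * (T - t n) \<and> \<sigma> \<le> Q * (T - s n) \<and>
    (\<forall>q\<in>?D. \<Psi> (\<nu> * inverse (real (Suc n))) (\<alpha> n) q \<le> \<Psi> (\<nu> * inverse (real (Suc n))) (\<alpha> n) ((t n, x n), (s n, y n)))"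
    by metis
  have Q: "0 < Q"
  proof (rule ccontr)
    assume "\<not> 0 < Q"
    then have "Q = 0" using Q_pos by simp
    then show False using sel[of 0] pos(3) by simp
  qed
  have near: "(x n)\<^sup>2 \<le> 4 * \<nu> * Q * inverse (real (Suc n)) \<and> (y n)\<^sup>2 \<le> 4 * \<nu> * Q * inverse (real (Suc n))" for n
  proof -
    have "(x n - y n)\<^sup>2 \<le> 4 * \<nu> * Q * inverse (real (Suc n))" using sel[of n] by (simp add: mult_ac)
    moreover have "0 \<le> 4 * \<nu> * Q * inverse (real (Suc n))" using Q pos by simp
    ultimately show ?thesis using sel[of n] by auto
  qed
  define Y where "Y = 1 + 4 * \<nu> * Q"
  have boundY: "z \<le> Y" if "z\<^sup>2 \<le> 4 * \<nu> * Q * inverse (real (Suc n))" for z :: real and n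
  proof -
    have "inverse (real (Suc n)) \<le> 1" by (intro inverse_le_1_iff[THEN iffD2]) simp
    then have "4 * \<nu> * Q * inverse (real (Suc n)) \<le> 4 * \<nu> * Q * 1" using Q pos by (intro mult_left_mono) auto
    then show ?thesis using that abs_le_one_plus_square[of z] unfolding Y_def by linarith
  qed
  define P where "P = (\<lambda>n. ((t n, x n), (s n, y n)))"
  let ?J = "{0..T - \<sigma> / Q} \<times> {0..Y}"
  have "P n \<in> ?J \<times> ?J" for n
  proof -
    have "\<sigma> / Q \<le> T - t n" "\<sigma> / Q \<le> T - s n" using sel[of n] Q by (auto simp: field_simps)
    then show ?thesis using sel[of n] near[of n] boundY[of "x n" n] boundY[of "y n" n] by (auto simp: P_def)
  qed
  moreover have "seq_compact (?J \<times> ?J)" by (intro compact_imp_seq_compact compact_Times) auto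
  ultimately obtain l r where l: "l \<in> ?J \<times> ?J" "strict_mono r" "(P \<circ> r) \<longlonglongrightarrow> l"
    unfolding seq_compact_def by blast
  obtain t0 x0 s0 y0 where q: "l = ((t0, x0), (s0, y0))" by (metis surj_pair)
  have sub: "?J \<times> ?J \<subseteq> ?D" using divide_pos_pos[OF pos(3) Q] by (auto simp: dom_init_def)
  have lD: "l \<in> ?D" using l sub by blast
  have PD: "P n \<in> ?D" for n using \<open>\<And>n. P n \<in> ?J \<times> ?J\<close> sub by blast
  have inv0: "(\<lambda>n. c * inverse (real (Suc (r n)))) \<longlonglongrightarrow> 0" for c
    using LIMSEQ_subseq_LIMSEQ[OF LIMSEQ_inverse_real_of_nat l(2)] tendsto_mult_right_zero by (fastforce simp: o_def)
  have lim_eq_0: "z0 = 0" if "(\<lambda>n. z (r n)) \<longlonglongrightarrow> z0" "\<And>n. (z n)\<^sup>2 \<le> 4 * \<nu> * Q * inverse (real (Suc n))"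
    for z :: "nat \<Rightarrow> real" and z0
  proof -
    have "(\<lambda>n. (z (r n))\<^sup>2) \<longlonglongrightarrow> z0\<^sup>2" using that(1) by (intro tendsto_power)
    then have "z0\<^sup>2 \<le> 0" using inv0[of "4 * \<nu> * Q"] that(2) by (intro LIMSEQ_le) auto
    then show ?thesis by simp
  qed
  have "(\<lambda>n. snd (fst (P (r n)))) \<longlonglongrightarrow> snd (fst l)" "(\<lambda>n. snd (snd (P (r n)))) \<longlonglongrightarrow> snd (snd l)"
    using l(3) by (auto intro!: tendsto_fst tendsto_snd simp: o_def)
  then have "x0 = 0" "y0 = 0" using lim_eq_0[of x x0] lim_eq_0[of y y0] near by (auto simp: P_def q)
  have max: "A (t', x') + B (s', x') - (t' - s')\<^sup>2 / (2 * \<nu>) \<le> A (t0, 0) + B (s0, 0) - (t0 - s0)\<^sup>2 / (2 * \<nu>)"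
    if d: "0 \<le> t'" "t' < T" "0 \<le> s'" "s' < T" "0 \<le> x'" for t' s' x'
  proof -
    let ?\<Phi> = "\<lambda>q. A (fst q) + B (snd q) - (fst (fst q) - fst (snd q))\<^sup>2 / (2 * \<nu>)"
    let ?b = "\<lambda>n. A (t', x') + B (s', x') - (t' - s')\<^sup>2 / (2 * \<nu>) - x' * inverse (real (Suc (r n)))"
    have u: "usc_on ?D ?\<Phi>"
      using pos by (intro usc_on_diff usc_on_add usc_on_compose[OF uscA] usc_on_compose[OF uscB] continuous_intros) auto
    have "?b \<longlonglongrightarrow> A (t', x') + B (s', x') - (t' - s')\<^sup>2 / (2 * \<nu>) - 0"
      by (intro tendsto_diff tendsto_const inv0)
    moreover have "?b n \<le> ?\<Phi> ((P \<circ> r) n)" for n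
    proof -
      let ?n = "r n"
      let ?\<epsilon> = "\<nu> * inverse (real (Suc ?n))"
      have "((t', x'), (s', x')) \<in> ?D" using d by (simp add: dom_init_def)
      then have "\<Psi> ?\<epsilon> (\<alpha> ?n) ((t', x'), (s', x')) \<le> \<Psi> ?\<epsilon> (\<alpha> ?n) (P ?n)" using sel[of ?n] by (simp add: P_def)
      moreover have "\<Psi> ?\<epsilon> (\<alpha> ?n) (P ?n) \<le> ?\<Phi> (P ?n)"
      proof -
        have "0 \<le> (x ?n - y ?n)\<^sup>2 / (2 * ?\<epsilon>)" using pos by (intro divide_nonneg_nonneg) auto
        moreover have "0 \<le> \<alpha> ?n * x ?n" using sel[of ?n] by (intro mult_nonneg_nonneg) auto
        ultimately show ?thesis by (simp add: \<Psi>_def P_def)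
      qed
      moreover have "\<alpha> ?n * x' \<le> inverse (real (Suc ?n)) * x'" using sel[of ?n] d by (intro mult_right_mono) auto
      ultimately show ?thesis by (simp add: \<Psi>_def mult.commute)
    qed
    ultimately have "A (t', x') + B (s', x') - (t' - s')\<^sup>2 / (2 * \<nu>) - 0 \<le> ?\<Phi> l"
      using PD by (intro usc_on_limit_ge[OF u lD l(3)]) auto
    then show ?thesis using q \<open>x0 = 0\<close> \<open>y0 = 0\<close> by simp
  qed
  have d0: "0 \<le> t0" "t0 < T" "0 \<le> s0" "s0 < T" using lD q by (auto simp: dom_init_def)
  have "0 < t0 \<and> 0 < s0"
  proof (rule positive_times[where \<epsilon> = \<nu> and \<alpha> = 0 and x = 0 and y = 0])
    show "\<delta> + L\<^sup>2 * \<nu> < \<Psi> \<nu> 0 ((t0, 0), (s0, 0))"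
      using max[of t1 t1 x1] base by (simp add: \<Psi>_def)
  qed (use d0 pos in auto)
  then show ?thesis using that[of t0 s0] max d0 by blast
qed

end

section \<open>Profiles at a boundary maximum\<close>

text \<open>
  Along \<open>x = 0\<close> the function is bounded above by a parabola in time of curvature \<open>2 / \<nu>\<close>; subtracting
  one of twice that curvature makes \<open>t0\<close> a strict maximum, whence \<open>side\<close> by semicontinuity. In
  exchange the time derivative of the test functions varies over the time interval; \<open>r\<close> is so
  small that this uses up at most half of the margin \<open>m\<close>.
\<close>

lemma boundary_profile_of_visc_sub:
  assumes usc: "usc_on (dom_init T) A" and visc: "strict_visc_sub T H F m A" and pos: "0 < m" "0 < \<nu>"
    and t0: "0 < t0" "t0 < T"
    and time: "\<And>t. 0 \<le> t \<Longrightarrow> t < T \<Longrightarrow> A (t, 0) \<le> A (t0, 0) + \<beta> * (t - t0) + (t - t0)\<^sup>2 / \<nu>"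
  obtains r R \<kappa> where "r < t0" "t0 + r < T"
    "boundary_profile H F (- \<beta> - m / 2) (\<lambda>\<tau> x. A (t0 + \<tau>, x) - A (t0, 0) - \<beta> * \<tau> - 2 * \<tau>\<^sup>2 / \<nu>) r R \<kappa>"
proof -
  define W where "W = (\<lambda>\<tau> x. A (t0 + \<tau>, x) - A (t0, 0) - \<beta> * \<tau> - 2 * \<tau>\<^sup>2 / \<nu>)"
  define r where "r = min (min (t0 / 2) ((T - t0) / 2)) (m * \<nu> / 8)"
  have r: "0 < r" using t0 pos by (simp add: r_def)
  have r_le: "r \<le> t0 / 2" "r \<le> (T - t0) / 2" "r \<le> m * \<nu> / 8"
    unfolding r_def min_le_iff_disj by simp_all
  have r_less: "r < t0" using r_le(1) t0 by simp
  have r_less': "t0 + r < T" using r_le(2) t0 by (simp add: field_simps)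
  note r = r r_less r_less' r_le(3)
  have drift: "- (m / 2) \<le> 4 * \<tau> / \<nu>" if "\<bar>\<tau>\<bar> \<le> r" for \<tau>
  proof -
    have "- (m * \<nu> / 8) \<le> \<tau>" using that r by linarith
    then show ?thesis using pos by (simp add: field_simps)
  qed
  define \<kappa> where "\<kappa> = r\<^sup>2 / (2 * \<nu>)"
  have \<kappa>: "0 < \<kappa>" using r pos by (simp add: \<kappa>_def)
  have W_bdry: "W \<tau> 0 \<le> - (\<tau>\<^sup>2 / \<nu>)" if "\<bar>\<tau>\<bar> \<le> r" for \<tau>
  proof -
    have "0 \<le> t0 + \<tau>" "t0 + \<tau> < T" using that r by linarith+
    moreover have "2 * \<tau>\<^sup>2 / \<nu> = \<tau>\<^sup>2 / \<nu> + \<tau>\<^sup>2 / \<nu>" by simp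
    ultimately show ?thesis using time[of "t0 + \<tau>"] unfolding W_def by simp
  qed
  have side: "\<exists>R>0. \<forall>x\<in>{0..R}. W \<tau> x < - \<kappa>" if "\<bar>\<tau>\<bar> = r" for \<tau>
  proof -
    have "\<tau>\<^sup>2 = r\<^sup>2" using that by (metis power2_abs)
    then have "W \<tau> 0 < - \<kappa>" using W_bdry[of \<tau>] that \<kappa> by (simp add: \<kappa>_def)
    then have "A (t0 + \<tau>, 0) < A (t0, 0) + \<beta> * \<tau> + 2 * \<tau>\<^sup>2 / \<nu> - \<kappa>" by (simp add: W_def)
    moreover have p: "(t0 + \<tau>, 0) \<in> dom_init T" using that r by (auto simp: dom_init_def)
    ultimately obtain V where V: "open V" "(t0 + \<tau>, 0) \<in> V"
      "\<forall>q\<in>V \<inter> dom_init T. A q < A (t0, 0) + \<beta> * \<tau> + 2 * \<tau>\<^sup>2 / \<nu> - \<kappa>"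
      using usc_on_eventually_less[OF usc] by blast
    obtain e where e: "0 < e" "ball (t0 + \<tau>, 0) e \<subseteq> V" using V open_contains_ball by blast
    have "W \<tau> x < - \<kappa>" if "x \<in> {0..e / 2}" for x
    proof -
      have "(t0 + \<tau>, x) \<in> ball (t0 + \<tau>, 0) e" using that e by (auto simp: dist_Pair_Pair dist_real_def)
      moreover have "(t0 + \<tau>, x) \<in> dom_init T" using p that by (auto simp: dom_init_def)
      ultimately have "A (t0 + \<tau>, x) < A (t0, 0) + \<beta> * \<tau> + 2 * \<tau>\<^sup>2 / \<nu> - \<kappa>" using V e by blast
      then show ?thesis by (simp add: W_def)
    qed
    then show ?thesis using e by (intro exI[of _ "e / 2"]) auto
  qed
  obtain R1 R2 where R12: "R1 > 0" "\<forall>x\<in>{0..R1}. W r x < - \<kappa>" "R2 > 0" "\<forall>x\<in>{0..R2}. W (- r) x < - \<kappa>"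
    using side[of r] side[of "- r"] r by auto
  define R where "R = min R1 R2"
  have R: "0 < R" using R12 by (simp add: R_def)
  have D: "((\<lambda>t. \<beta> * (t - t0) + 2 * (t - t0)\<^sup>2 / \<nu>) has_real_derivative \<beta> + 4 * (t - t0) / \<nu>) (at t)" for t
    using pos by (auto intro!: derivative_eq_intros)
  have D': "((\<lambda>x. p * x + k * x\<^sup>2) has_real_derivative p + 2 * k * x) (at x)" for p k x :: real
    by (auto intro!: derivative_eq_intros)
  have touch: "H (p + 2 * k * x) \<le> - \<beta> - m / 2 \<or> x = 0 \<and> F (p + 2 * k * x) \<le> - \<beta> - m / 2"
    if "\<bar>\<tau>\<bar> < r" "0 \<le> x" "open V" "(\<tau>, x) \<in> V"
      and top: "\<And>q. q \<in> V \<Longrightarrow> 0 \<le> snd q \<Longrightarrow> W (fst q) (snd q) - p * snd q - k * (snd q)\<^sup>2 \<le> W \<tau> x - p * x - k * x\<^sup>2"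
    for \<tau> x p k V
  proof -
    let ?f = "\<lambda>t. \<beta> * (t - t0) + 2 * (t - t0)\<^sup>2 / \<nu>"
    let ?g = "\<lambda>x. p * x + k * x\<^sup>2"
    have "(\<beta> + 4 * (t0 + \<tau> - t0) / \<nu>) + m + H (p + 2 * k * x) \<le> 0 \<or>
        x = 0 \<and> (\<beta> + 4 * (t0 + \<tau> - t0) / \<nu>) + m + F (p + 2 * k * x) \<le> 0"
    proof (rule strict_visc_subD[OF visc D _ D', where t = "t0 + \<tau>"])
      show "continuous_on {0<..<T} (\<lambda>t. \<beta> + 4 * (t - t0) / \<nu>)"
        by (intro continuous_intros) (use pos in auto)
      show "continuous_on {0..} (\<lambda>x. p + 2 * k * x)" by (intro continuous_intros)
      show "0 < t0 + \<tau>" "t0 + \<tau> < T" "0 \<le> x" using that r by auto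
      have "open ((\<lambda>q. (fst q - t0, snd q)) -` V)"
        by (intro open_vimage that continuous_intros)
      moreover have "A q - ?f (fst q) - ?g (snd q) \<le> A (t0 + \<tau>, x) - ?f (t0 + \<tau>) - ?g x"
        if "q \<in> (\<lambda>q. (fst q - t0, snd q)) -` V" "q \<in> dom_pos T" for q
        using top[of "(fst q - t0, snd q)"] that by (auto simp: W_def dom_pos_def)
      ultimately show "\<forall>\<^sub>F q in at (t0 + \<tau>, x) within dom_pos T.
          A q - ?f (fst q) - ?g (snd q) \<le> A (t0 + \<tau>, x) - ?f (t0 + \<tau>) - ?g x"
        using that(4) unfolding eventually_at_topological
        by (intro exI[of _ "(\<lambda>q. (fst q - t0, snd q)) -` V"]) auto
    qed
    moreover have "- (m / 2) \<le> 4 * (t0 + \<tau> - t0) / \<nu>" using drift[of \<tau>] that by simp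
    ultimately show ?thesis by linarith
  qed
  have "boundary_profile H F (- \<beta> - m / 2) W r R \<kappa>"
  proof
    show "0 < r" "0 < R" "0 < \<kappa>" by fact+
    show "usc_on ({- r..r} \<times> {0..R}) (\<lambda>q. W (fst q) (snd q))"
      unfolding W_def using r pos
      by (intro usc_on_diff usc_on_compose[OF usc] continuous_intros) (auto simp: dom_init_def)
    show "W \<tau> 0 \<le> 0" if "\<tau> \<in> {- r..r}" for \<tau>
    proof -
      have "\<bar>\<tau>\<bar> \<le> r" using that by auto
      moreover have "0 \<le> \<tau>\<^sup>2 / \<nu>" using pos by simp
      ultimately show ?thesis using W_bdry[of \<tau>] by linarith
    qed
    show "W \<tau> x < - \<kappa>" if "\<bar>\<tau>\<bar> = r" "x \<in> {0..R}" for \<tau> x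
    proof -
      have "\<tau> = r \<or> \<tau> = - r" using that by auto
      then show ?thesis using that R12 by (auto simp: R_def)
    qed
    show "H (p + 2 * k * x) \<le> - \<beta> - m / 2"
      if "\<bar>\<tau>\<bar> < r" "0 < x" "x < R" and
        top: "\<forall>\<^sub>F q in at (\<tau>, x). W (fst q) (snd q) - p * snd q - k * (snd q)\<^sup>2 \<le> W \<tau> x - p * x - k * x\<^sup>2"
      for \<tau> x p k
    proof -
      obtain V where V: "open V" "(\<tau>, x) \<in> V"
        "\<forall>q\<in>V. q \<noteq> (\<tau>, x) \<longrightarrow> W (fst q) (snd q) - p * snd q - k * (snd q)\<^sup>2 \<le> W \<tau> x - p * x - k * x\<^sup>2"
        using top unfolding eventually_at_topological by auto
      have "W (fst q) (snd q) - p * snd q - k * (snd q)\<^sup>2 \<le> W \<tau> x - p * x - k * x\<^sup>2" if "q \<in> V" for q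
        using V(3) that by (cases "q = (\<tau>, x)") auto
      then show ?thesis using touch[of \<tau> x V p k] V that by auto
    qed
    show "H p \<le> - \<beta> - m / 2 \<or> F p \<le> - \<beta> - m / 2"
      if \<rho>: "0 < \<rho>" "\<rho> \<le> R" "\<forall>\<tau>\<in>{- r..r}. \<forall>x\<in>{0..\<rho>}. W \<tau> x \<le> p * x" for p \<rho>
    proof -
      have "H (p + 2 * 0 * 0) \<le> - \<beta> - m / 2 \<or> (0::real) = 0 \<and> F (p + 2 * 0 * 0) \<le> - \<beta> - m / 2"
      proof (rule touch[where \<tau> = 0 and V = "{- r<..<r} \<times> {..<\<rho>}"])
        show "open ({- r<..<r} \<times> {..<\<rho>})" by (intro open_Times) auto
        fix q assume "q \<in> {- r<..<r} \<times> {..<\<rho>}" "0 \<le> snd q"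
        then have "W (fst q) (snd q) \<le> p * snd q" using \<rho> by auto
        then show "W (fst q) (snd q) - p * snd q - 0 * (snd q)\<^sup>2 \<le> W 0 0 - p * 0 - 0 * 0\<^sup>2"
          by (simp add: W_def)
      qed (use r \<rho> in auto)
      then show ?thesis by simp
    qed
  qed
  then show ?thesis using that r unfolding W_def by blast
qed

section \<open>Comparison\<close>

lemma usc_env_growth:
  assumes u: "\<And>t x. 0 < t \<Longrightarrow> t < T \<Longrightarrow> 0 \<le> x \<Longrightarrow> u (t, x) \<le> C * (1 + x)" and "0 < C"
    and lb: "locally_bounded_on (dom_init T) u" and tx: "0 < t" "t < T" "0 \<le> x"
  shows "real_of_ereal (usc_env (dom_init T) u (t, x)) \<le> C * (1 + x)"
proof (rule field_le_epsilon)
  fix e :: real assume e: "0 < e"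
  let ?V = "{0<..<T} \<times> {..<x + e / C}"
  have "usc_env (dom_init T) u (t, x) \<le> ereal (C * (1 + x) + e)"
  proof (rule usc_env_le[where V = ?V])
    show "open ?V" by (intro open_Times) auto
    show "(t, x) \<in> ?V" using tx e assms(2) by auto
    fix q assume q: "q \<in> ?V \<inter> dom_init T"
    then have "u q \<le> C * (1 + snd q)" using u[of "fst q" "snd q"] by (auto simp: dom_init_def)
    also have "\<dots> \<le> C * (1 + (x + e / C))" using q assms(2) by (intro mult_left_mono) auto
    also have "\<dots> = C * (1 + x) + e" using assms(2) by (simp add: field_simps)
    finally show "u q \<le> C * (1 + x) + e" .
  qed
  moreover have "(t, x) \<in> dom_init T" using tx by (simp add: dom_init_def)
  ultimately have "ereal (real_of_ereal (usc_env (dom_init T) u (t, x))) \<le> ereal (C * (1 + x) + e)"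
    by (subst real_usc_env[OF lb])
  then show "real_of_ereal (usc_env (dom_init T) u (t, x)) \<le> C * (1 + x) + e" by simp
qed

lemma relaxed_subsolution_envelope:
  assumes "relaxed_subsolution T H F w u" "0 < T" "0 < C"
    and "\<And>t x. 0 < t \<Longrightarrow> t < T \<Longrightarrow> 0 \<le> x \<Longrightarrow> u (t, x) \<le> C * (1 + x)"
  obtains U where "usc_on (dom_init T) U" "strict_visc_sub T H F 0 U"
    "\<And>p. p \<in> dom_init T \<Longrightarrow> u p \<le> U p" "\<And>x. 0 \<le> x \<Longrightarrow> U (0, x) \<le> w x"
    "\<And>t x. 0 < t \<Longrightarrow> t < T \<Longrightarrow> 0 \<le> x \<Longrightarrow> U (t, x) \<le> C * (1 + x)"
proof -
  let ?U = "\<lambda>p. real_of_ereal (usc_env (dom_init T) u p)"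
  have lb: "locally_bounded_on (dom_init T) u" using assms(1) by (simp add: relaxed_subsolution_def)
  have 1: "u p \<le> ?U p" if "p \<in> dom_init T" for p
  proof -
    have "ereal (u p) \<le> ereal (?U p)" unfolding real_usc_env[OF lb that] by (rule usc_env_ge[OF that])
    then show ?thesis by simp
  qed
  have 2: "?U (0, x) \<le> w x" if "0 \<le> x" for x
  proof -
    have p: "(0, x) \<in> dom_init T" using that assms(2) by (simp add: dom_init_def)
    have "ereal (?U (0, x)) \<le> ereal (w x)"
      unfolding real_usc_env[OF lb p] using assms(1) that by (simp add: relaxed_subsolution_def)
    then show ?thesis by simp
  qed
  show ?thesis
    by (rule that[OF usc_on_usc_env[OF lb] relaxed_subsolution_visc[OF assms(1)] 1 2
          usc_env_growth[OF assms(4,3) lb]])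
qed

text \<open>
  The penalty \<open>\<sigma>\<close> and the time doubling \<open>\<nu>\<close> are fixed so that a positive value \<open>\<theta>\<close> of \<open>U + V\<close>
  survives: \<open>\<theta> / 4\<close> is spent on the two penalties at \<open>t1\<close>, and \<open>\<theta> / 4 + L\<^sup>2 \<nu> < \<theta> / 2\<close> is what
  \<open>doubled_pair\<close> requires. At the boundary maximum both functions have the same time slope
  \<open>\<beta> = (t0 - s0) / \<nu>\<close>, so the margins separate the levels \<open>- \<beta> - m / 2\<close> and \<open>- \<beta> + m / 2\<close> of the
  two profiles.
\<close>

lemma no_positive_gap:
  fixes H F w :: "real \<Rightarrow> real"
  assumes H: "continuous_on UNIV H" and Fbot: "filterlim F at_top at_bot"
    and alt: "filterlim F at_bot at_top \<or> filterlim H at_top at_infinity"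
    and T: "0 < T"
    and uscU: "usc_on (dom_init T) U" and viscU: "strict_visc_sub T H F 0 U"
    and uscV: "usc_on (dom_init T) V"
    and viscV: "strict_visc_sub T (\<lambda>p. - H (- p)) (\<lambda>p. - F (- p)) 0 V"
    and close: "\<And>\<delta>. 0 < \<delta> \<Longrightarrow> \<exists>L\<ge>0. \<forall>t s x y. 0 \<le> t \<longrightarrow> t < T \<longrightarrow> 0 \<le> s \<longrightarrow> s < T \<longrightarrow> 0 \<le> x \<longrightarrow> 0 \<le> y \<longrightarrow>
        U (t, x) + V (s, y) \<le> \<delta> + L * (t + s) + L * \<bar>x - y\<bar>"
    and p1: "0 \<le> t1" "t1 < T" "0 \<le> x1"
  shows "U (t1, x1) + V (t1, x1) \<le> 0"
proof (rule ccontr)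
  define \<theta> where "\<theta> = U (t1, x1) + V (t1, x1)"
  assume "\<not> ?thesis"
  then have \<theta>: "0 < \<theta>" by (simp add: \<theta>_def)
  obtain L where L: "0 \<le> L" and bound: "\<And>t s x y. 0 \<le> t \<Longrightarrow> t < T \<Longrightarrow> 0 \<le> s \<Longrightarrow> s < T \<Longrightarrow> 0 \<le> x \<Longrightarrow> 0 \<le> y \<Longrightarrow>
      U (t, x) + V (s, y) \<le> \<theta> / 4 + L * (t + s) + L * \<bar>x - y\<bar>"
    using close[of "\<theta> / 4"] \<theta> by auto
  define \<sigma> where "\<sigma> = \<theta> / 8 * (T - t1)"
  have "0 < T - t1" using p1 by simp
  then have \<sigma>: "0 < \<sigma>" "\<sigma> / (T - t1) = \<theta> / 8" using \<theta> unfolding \<sigma>_def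
    by (simp, intro nonzero_mult_div_cancel_right) simp
  define \<nu> where "\<nu> = \<theta> / (4 * (L\<^sup>2 + 1))"
  have "0 < L\<^sup>2 + 1" by (simp add: add_nonneg_pos)
  then have \<nu>: "0 < \<nu>" "L\<^sup>2 * \<nu> < \<theta> / 4" using \<theta> by (auto simp: \<nu>_def field_simps)
  define m where "m = \<sigma> / T\<^sup>2"
  have m: "0 < m" using \<sigma> T by (simp add: m_def)
  define A where "A = (\<lambda>q. U q - \<sigma> / (T - fst q))"
  define B where "B = (\<lambda>q. V q - \<sigma> / (T - fst q))"
  interpret doubled_pair T m "\<theta> / 4" L \<sigma> \<nu> t1 x1 H F A B
  proof
    show "usc_on (dom_init T) A" "usc_on (dom_init T) B"
      unfolding A_def B_def by (rule usc_on_penalised[OF uscU] usc_on_penalised[OF uscV])+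
    show "strict_visc_sub T H F m A" "strict_visc_sub T (\<lambda>p. - H (- p)) (\<lambda>p. - F (- p)) m B"
      unfolding A_def B_def m_def
      by (rule penalised_visc_sub[OF viscU \<sigma>(1)] penalised_visc_sub[OF viscV \<sigma>(1)])+
    show "A (t, x) + B (s, y) \<le> \<theta> / 4 + L * (t + s) + L * \<bar>x - y\<bar> - \<sigma> / (T - t) - \<sigma> / (T - s)"
      if "0 \<le> t" "t < T" "0 \<le> s" "s < T" "0 \<le> x" "0 \<le> y" for t s x y
      using bound[OF that] by (simp add: A_def B_def)
    have "A (t1, x1) + B (t1, x1) = \<theta> - \<sigma> / (T - t1) - \<sigma> / (T - t1)"
      by (simp add: A_def B_def \<theta>_def)
    then show "\<theta> / 4 + L\<^sup>2 * \<nu> < A (t1, x1) + B (t1, x1)" using \<sigma>(2) \<nu> \<theta> by linarith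
  qed (use T m \<sigma> L \<theta> \<nu> H p1 in auto)
  obtain t0 s0 where t0: "0 < t0" "t0 < T" and s0: "0 < s0" "s0 < T"
    and max: "\<And>t s x. 0 \<le> t \<Longrightarrow> t < T \<Longrightarrow> 0 \<le> s \<Longrightarrow> s < T \<Longrightarrow> 0 \<le> x \<Longrightarrow>
      A (t, x) + B (s, x) - (t - s)\<^sup>2 / (2 * \<nu>) \<le> A (t0, 0) + B (s0, 0) - (t0 - s0)\<^sup>2 / (2 * \<nu>)"
    by (rule boundary_maximum) (rule that, assumption+)
  define \<beta> where "\<beta> = (t0 - s0) / \<nu>"
  \<comment> \<open>The maximality, with the square of \<open>(t - s) - (t0 - s0)\<close> split between the two times so that each
    profile gets its own quadratic term.\<close>
  have split: "A (t, x) + B (s, x) \<le> A (t0, 0) + B (s0, 0) + \<beta> * (t - t0) + - \<beta> * (s - s0)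
      + (t - t0)\<^sup>2 / \<nu> + (s - s0)\<^sup>2 / \<nu>"
    if "0 \<le> t" "t < T" "0 \<le> s" "s < T" "0 \<le> x" for t s x
  proof -
    define d where "d = (t - t0) - (s - s0)"
    have "(t - s)\<^sup>2 = (t0 - s0)\<^sup>2 + 2 * (t0 - s0) * d + d\<^sup>2"
      by (simp add: d_def power2_eq_square algebra_simps)
    moreover have "2 * (t0 - s0) * d / (2 * \<nu>) = \<beta> * d" using \<nu>(1) by (simp add: \<beta>_def field_simps)
    ultimately have "(t - s)\<^sup>2 / (2 * \<nu>) = (t0 - s0)\<^sup>2 / (2 * \<nu>) + \<beta> * d + d\<^sup>2 / (2 * \<nu>)"
      by (simp only: add_divide_distrib)
    moreover have "d\<^sup>2 \<le> 2 * ((t - t0)\<^sup>2 + (s - s0)\<^sup>2)"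
    proof -
      have "(a - b)\<^sup>2 + (a + b)\<^sup>2 = 2 * (a\<^sup>2 + b\<^sup>2)" for a b :: real
        by (simp add: power2_eq_square algebra_simps)
      then show ?thesis unfolding d_def by (metis le_add_same_cancel1 zero_le_power2)
    qed
    then have "d\<^sup>2 / (2 * \<nu>) \<le> 2 * ((t - t0)\<^sup>2 + (s - s0)\<^sup>2) / (2 * \<nu>)"
      using \<nu> by (intro divide_right_mono) auto
    then have "d\<^sup>2 / (2 * \<nu>) \<le> (t - t0)\<^sup>2 / \<nu> + (s - s0)\<^sup>2 / \<nu>" by (simp add: add_divide_distrib)
    moreover have "\<beta> * d = \<beta> * (t - t0) + - \<beta> * (s - s0)" by (simp add: d_def algebra_simps)
    ultimately show ?thesis using max[OF that] by linarith
  qed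
  obtain r R \<kappa> where r: "r < t0" "t0 + r < T" and W:
    "boundary_profile H F (- \<beta> - m / 2) (\<lambda>\<tau> x. A (t0 + \<tau>, x) - A (t0, 0) - \<beta> * \<tau> - 2 * \<tau>\<^sup>2 / \<nu>) r R \<kappa>"
  proof (rule boundary_profile_of_visc_sub[OF uscA viscA m \<nu>(1) t0])
    show "A (t, 0) \<le> A (t0, 0) + \<beta> * (t - t0) + (t - t0)\<^sup>2 / \<nu>" if "0 \<le> t" "t < T" for t
      using split[of t s0 0] that s0 by simp
  qed (rule that, assumption+)
  obtain r' R' \<kappa>' where r': "r' < s0" "s0 + r' < T" and Z:
    "boundary_profile (\<lambda>p. - H (- p)) (\<lambda>p. - F (- p)) (- (- \<beta>) - m / 2)
      (\<lambda>\<tau> x. B (s0 + \<tau>, x) - B (s0, 0) - (- \<beta>) * \<tau> - 2 * \<tau>\<^sup>2 / \<nu>) r' R' \<kappa>'"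
  proof (rule boundary_profile_of_visc_sub[OF uscB viscB m \<nu>(1) s0])
    show "B (s, 0) \<le> B (s0, 0) + - \<beta> * (s - s0) + (s - s0)\<^sup>2 / \<nu>" if "0 \<le> s" "s < T" for s
      using split[of t0 s 0] that t0 by simp
  qed (rule that, assumption+)
  have Z': "boundary_profile (\<lambda>p. - H (- p)) (\<lambda>p. - F (- p)) (- (- \<beta> + m / 2))
      (\<lambda>\<tau> x. B (s0 + \<tau>, x) - B (s0, 0) - (- \<beta>) * \<tau> - 2 * \<tau>\<^sup>2 / \<nu>) r' R' \<kappa>'"
    using Z by simp
  show False
  proof (rule boundary_profiles_contradiction[OF H Fbot alt _ W Z'])
    show "- \<beta> - m / 2 < - \<beta> + m / 2" using m by simp
    fix \<tau> \<tau>' x :: real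
    assume a: "\<tau> \<in> {- r..r}" "\<tau>' \<in> {- r'..r'}" "0 \<le> x"
    have "0 \<le> t0 + \<tau>" "t0 + \<tau> < T" "0 \<le> s0 + \<tau>'" "s0 + \<tau>' < T" using a r r' by auto
    from split[OF this a(3)]
    have "A (t0 + \<tau>, x) + B (s0 + \<tau>', x) \<le> A (t0, 0) + B (s0, 0) + \<beta> * \<tau> + - \<beta> * \<tau>' + \<tau>\<^sup>2 / \<nu> + \<tau>'\<^sup>2 / \<nu>"
      by simp
    moreover have "0 \<le> \<tau>\<^sup>2 / \<nu>" "0 \<le> \<tau>'\<^sup>2 / \<nu>" "2 * \<tau>\<^sup>2 / \<nu> = \<tau>\<^sup>2 / \<nu> + \<tau>\<^sup>2 / \<nu>" "2 * \<tau>'\<^sup>2 / \<nu> = \<tau>'\<^sup>2 / \<nu> + \<tau>'\<^sup>2 / \<nu>"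
      using \<nu> by auto
    ultimately show "A (t0 + \<tau>, x) - A (t0, 0) - \<beta> * \<tau> - 2 * \<tau>\<^sup>2 / \<nu>
        + (B (s0 + \<tau>', x) - B (s0, 0) - (- \<beta>) * \<tau>' - 2 * \<tau>'\<^sup>2 / \<nu>) \<le> 0"
      by linarith
  qed
qed

theorem theorem1p3:
  fixes H F u0 :: "real \<Rightarrow> real" and u v :: "real \<times> real \<Rightarrow> real" and T C :: real
  assumes "continuous_on UNIV H"
    and "continuous_on UNIV F"
    and "antimono F"
    and "filterlim F at_top at_bot"
    and "uniformly_continuous_on {0..} u0"
    and "filterlim F at_bot at_top \<or> filterlim H at_top at_infinity"
    and "T > 0"
    and "C > 0"
    and "relaxed_subsolution T H F u0 u"
    and "relaxed_supersolution T H F u0 v"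
    and "\<forall>t\<in>{0<..<T}. \<forall>x\<ge>0. u (t, x) \<le> C * (1 + x)"
    and "\<forall>t\<in>{0<..<T}. \<forall>x\<ge>0. v (t, x) \<ge> - C * (1 + x)"
  shows "\<forall>t\<in>{0..<T}. \<forall>x\<ge>0. u (t, x) \<le> v (t, x)"
proof (intro ballI allI impI)
  note H = assms(1) and F = assms(2) and T = assms(7) and C = assms(8)
  fix t1 x1 :: real assume t1: "t1 \<in> {0..<T}" and x1: "0 \<le> x1"
  have H': "continuous_on UNIV (\<lambda>p. - H (- p))" and F': "continuous_on UNIV (\<lambda>p. - F (- p))"
    by (intro continuous_intros continuous_on_compose2[OF H] continuous_on_compose2[OF F]; simp)+
  obtain U where U: "usc_on (dom_init T) U" "strict_visc_sub T H F 0 U"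
    "\<And>p. p \<in> dom_init T \<Longrightarrow> u p \<le> U p" "\<And>x. 0 \<le> x \<Longrightarrow> U (0, x) \<le> u0 x"
    "\<And>t x. 0 < t \<Longrightarrow> t < T \<Longrightarrow> 0 \<le> x \<Longrightarrow> U (t, x) \<le> C * (1 + x)"
    using relaxed_subsolution_envelope[OF assms(9) T C] assms(11) by auto
  have "- v (t, x) \<le> C * (1 + x)" if "0 < t" "t < T" "0 \<le> x" for t x
    using assms(12) that by (metis greaterThanLessThan_iff minus_le_iff mult_minus_left)
  then obtain V where V: "usc_on (dom_init T) V" "strict_visc_sub T (\<lambda>p. - H (- p)) (\<lambda>p. - F (- p)) 0 V"
    "\<And>p. p \<in> dom_init T \<Longrightarrow> - v p \<le> V p" "\<And>x. 0 \<le> x \<Longrightarrow> V (0, x) \<le> - u0 x"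
    "\<And>t x. 0 < t \<Longrightarrow> t < T \<Longrightarrow> 0 \<le> x \<Longrightarrow> V (t, x) \<le> C * (1 + x)"
    using relaxed_subsolution_envelope[OF reflect_supersolution[OF assms(10)] T C] by auto
  have "U (t1, x1) + V (t1, x1) \<le> 0"
  proof (rule no_positive_gap[OF H assms(4,6) T U(1,2) V(1,2)])
    fix \<delta> :: real assume \<delta>: "0 < \<delta>"
    then have \<delta>4: "0 < \<delta> / 4" by simp
    obtain K where K: "0 \<le> K" "\<And>x y. 0 \<le> x \<Longrightarrow> 0 \<le> y \<Longrightarrow> \<bar>u0 x - u0 y\<bar> \<le> \<delta> / 4 + K * \<bar>x - y\<bar>"
      using uniformly_continuous_modulus[OF assms(5) \<delta>4] by blast
    have K': "u0 x \<le> u0 y + \<delta> / 4 + K * \<bar>x - y\<bar>" "- u0 x \<le> - u0 y + \<delta> / 4 + K * \<bar>x - y\<bar>"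
      if "0 \<le> x" "0 \<le> y" for x y
      using K(2)[OF that] by linarith+
    obtain L1 where L1: "0 \<le> L1" "\<And>t x y. 0 \<le> t \<Longrightarrow> t < T \<Longrightarrow> 0 \<le> x \<Longrightarrow> 0 \<le> y \<Longrightarrow>
        U (t, x) \<le> u0 y + 2 * (\<delta> / 4) + K * \<bar>x - y\<bar> + L1 * t"
      using barrier_bound[OF H F T less_imp_le[OF C] U(1,2,4,5) \<delta>4 K(1) K'(1)] by blast
    obtain L2 where L2: "0 \<le> L2" "\<And>t x y. 0 \<le> t \<Longrightarrow> t < T \<Longrightarrow> 0 \<le> x \<Longrightarrow> 0 \<le> y \<Longrightarrow>
        V (t, x) \<le> - u0 y + 2 * (\<delta> / 4) + K * \<bar>x - y\<bar> + L2 * t"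
      using barrier_bound[OF H' F' T less_imp_le[OF C] V(1,2,4,5) \<delta>4 K(1) K'(2)] by blast
    define L where "L = K + L1 + L2"
    have "U (t, x) + V (s, y) \<le> \<delta> + L * (t + s) + L * \<bar>x - y\<bar>"
      if d: "0 \<le> t" "t < T" "0 \<le> s" "s < T" "0 \<le> x" "0 \<le> y" for t s x y
    proof -
      have "U (t, x) \<le> u0 y + 2 * (\<delta> / 4) + K * \<bar>x - y\<bar> + L1 * t" using L1(2)[OF d(1,2,5,6)] .
      moreover have "V (s, y) \<le> - u0 y + 2 * (\<delta> / 4) + L2 * s" using L2(2)[OF d(3,4,6,6)] by simp
      moreover have "L1 * t \<le> L * t" "L2 * s \<le> L * s" "K * \<bar>x - y\<bar> \<le> L * \<bar>x - y\<bar>"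
        unfolding L_def using K(1) L1(1) L2(1) d by (intro mult_right_mono; simp)+
      ultimately show ?thesis by (simp add: distrib_left)
    qed
    moreover have "0 \<le> L" using K(1) L1(1) L2(1) by (simp add: L_def)
    ultimately show "\<exists>L\<ge>0. \<forall>t s x y. 0 \<le> t \<longrightarrow> t < T \<longrightarrow> 0 \<le> s \<longrightarrow> s < T \<longrightarrow> 0 \<le> x \<longrightarrow> 0 \<le> y \<longrightarrow>
        U (t, x) + V (s, y) \<le> \<delta> + L * (t + s) + L * \<bar>x - y\<bar>" by blast
  qed (use t1 x1 in auto)
  moreover have "(t1, x1) \<in> dom_init T" using t1 x1 by (simp add: dom_init_def)
  ultimately show "u (t1, x1) \<le> v (t1, x1)" using U(3)[of "(t1, x1)"] V(3)[of "(t1, x1)"] by linarith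
qed

end
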